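(* Let $\boldsymbol n\in\mathbb N_0^p$ and $\boldsymbol m\in\mathbb N_0^q$. Assume that the parameters $(\boldsymbol a,\boldsymbol b,\boldsymbol\kappa)$ are regular and simultaneously admissible for the formulas displayed below (see context). (i) Assume that $|\boldsymbol n|=|\boldsymbol m|+1$ and that $\boldsymbol m$ is near the diagonal. For every $i\in\{1,\dots,p\}$ with $n_i\ge1$ set $$C_{\boldsymbol n,\boldsymbol m;i}:=(-1)^{|\boldsymbol n|}\frac{\Gamma(\kappa_i\mathbf 1_q+\boldsymbol b+\mathbf 1_q)}{\Gamma(\kappa_i\mathbf 1_r+\boldsymbol a+\mathbf 1_r)}\,\frac{\prod_{j=1}^q(\kappa_i+b_j+1)_{m_j}}{(-1)^{n_i-1}(n_i-1)!\prod_{\ell\ne i}(\kappa_i-\kappa_\ell-n_\ell+1)_{n_\ell}} .$$ For every nonzero scalar $\nu$ define, for $n_i\ge1$, $$A^{(i)}_{\boldsymbol n,\boldsymbol m}(z)=\nu\,C_{\boldsymbol n,\boldsymbol m;i}\;{}_{q+p}F_{r+p-1}\!\left(\begin{matrix}-n_i+1,\ \kappa_i\mathbf 1_q+\boldsymbol b+\boldsymbol m+\mathbf 1_q,\ \kappa_i\mathbf 1_{p-1}-\boldsymbol\kappa^{*i}-\boldsymbol n^{*i}+\mathbf 1_{p-1}\\ \kappa_i\mathbf 1_r+\boldsymbol a+\mathbf 1_r,\ \kappa_i\mathbf 1_{p-1}-\boldsymbol\kappa^{*i}+\mathbf 1_{p-1}\end{matrix};z\right),$$ and $A^{(i)}_{\boldsymbol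 n,\boldsymbol m}\equiv0$ if $n_i=0$. For $n_i\ge1$ the series terminates because of the numerator parameter $-n_i+1$, and hence $\deg A^{(i)}_{\boldsymbol n,\boldsymbol m}\le n_i-1$. Then $$\sum_{i=1}^p\oint_{\mathbb T}z^\ell C_{j,i}(z)A^{(i)}_{\boldsymbol n,\boldsymbol m}(z)\frac{\mathrm dz}{2\pi\mathrm i}=0,\qquad j\in\{1,\dots,q\},\ \ell\in\{0,\dots,m_j-1\}.$$ With $j_{\min}=j_{\min}(\boldsymbol m)$ and $m_{\min}=m_{\min}(\boldsymbol m)$, if $\nu$ is chosen as $$\nu^A_{\boldsymbol n,\boldsymbol m}:=-\frac{\prod_{i=1}^p(\kappa_i+b_{j_{\min}}+m_{\min}+1)_{n_i}}{(\boldsymbol a-b_{j_{\min}}\mathbf 1_r-m_{\min}\mathbf 1_r)_{m_{\min}}\prod_{h:\,m_h=m_{\min}+1}(b_h-b_{j_{\min}})},$$ then the normalized vector satisfies $$\sum_{i=1}^p\oint_{\mathbb T}z^{m_{\min}}C_{j_{\min},i}(z)A^{(i)}_{\boldsymbol n,\boldsymbol m}(z)\frac{\mathrm dz}{2\pi\mathrm i}=1.$$ (ii) Assume that $|\boldsymbol m|=|\boldsymbol n|+1$ and that $\boldsymbol m$ is near the diagonal. For $H\in\{1,\dots,q\}$ and $K\in\{0,\dots,m_H-1\}$ set $$\pi_{H,K}:=-\frac{\prod_{i=1}^p(\kappa_i+b_H+K+1)_{n_i}}{(-1)^KK!\,(m_H-K-1)!\prod_{I\ne H}(b_I-b_H-K)_{m_I}}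 .$$ In particular, for $m_j\ge1$, $$\pi_{j,0}=-\frac{\prod_{i=1}^p(\kappa_i+b_j+1)_{n_i}}{(m_j-1)!\prod_{I\ne j}(b_I-b_j)_{m_I}};$$ when $m_j=0$ set $\pi_{j,0}:=0$. For every nonzero scalar $\nu$ and every $j$ with $m_j\ge1$ define $$B^{(j)}_{\boldsymbol n,\boldsymbol m}(z)=\nu\Bigg[\pi_{j,0}+\frac{(\boldsymbol a-b_j\mathbf 1_r)_1}{(\boldsymbol b^{*j}-b_j\mathbf 1_{q-1})_1}\sum_{H=1}^q\sum_{K=1}^{m_H-1}\pi_{H,K}\frac{(\boldsymbol b^{*j}-(b_H+K)\mathbf 1_{q-1})_1}{(\boldsymbol a-(b_H+K)\mathbf 1_r)_1}\;{}_{q+1}F_r\!\left(\begin{matrix}1,\ \boldsymbol b-(b_H+K)\mathbf 1_q+\mathbf 1_q-\boldsymbol e_j\\ \boldsymbol a-(b_H+K)\mathbf 1_r+\mathbf 1_r\end{matrix};z\right)\Bigg],$$ and $B^{(j)}_{\boldsymbol n,\boldsymbol m}\equiv0$ if $m_j=0$. For every $j$ with $m_j\ge1$ one has $\deg B^{(j)}_{\boldsymbol n,\boldsymbol m}\le m_j-1$, and $$\sum_{j=1}^q\oint_{\mathbb T}z^\ell B^{(j)}_{\boldsymbol n,\boldsymbol m}(z)C_{j,i}(z)\frac{\mathrm dz}{2\pi\mathrm i}=0,\qquad i\in\{1,\dots,p\},\ \ell\in\{0,\dots,n_i-1\}.$$ With $j_{\max}=j_{\max}(\boldsymbol m)$ and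 $m_{\max}=m_{\max}(\boldsymbol m)$, if $\nu$ is chosen as $$\nu^B_{\boldsymbol n,\boldsymbol m}:=-\frac{(\boldsymbol a-b_{j_{\max}}\mathbf 1_r-(m_{\max}-1)\mathbf 1_r)_{m_{\max}}\prod_{h\ne j_{\max},\,m_h=m_{\max}}(b_h-b_{j_{\max}})}{(\boldsymbol a-b_{j_{\max}}\mathbf 1_r)_1\prod_{i=1}^p(\kappa_i+b_{j_{\max}}+m_{\max})_{n_i}},$$ then the component $B^{(j_{\max})}_{\boldsymbol n,\boldsymbol m}$ is monic. After step-line specialization, that is, for $(\boldsymbol n,\boldsymbol m)=(\boldsymbol\sigma_p(N),\boldsymbol\sigma_q(N+1))$ with $N\in\mathbb N_0$, the row vector $\big(B^{(1)}_{\boldsymbol n,\boldsymbol m},\dots,B^{(q)}_{\boldsymbol n,\boldsymbol m}\big)$ with this normalization is the monic $B$-vector supplied by the lower unitriangular Gauss–Borel factor $S$ (the row of index $N$ of $S\,X_{[q]}(z)$; see context).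
   Context: Notation. $\mathbf 1_d$: all-ones vector of length $d$; $\boldsymbol e_j$: standard basis vector; $|\boldsymbol n|=\sum_i n_i$; $\boldsymbol c^{*i}$: the vector $\boldsymbol c$ with its $i$-th component removed. $(x)_n$ is the Pochhammer symbol; for vectors $\Gamma(\boldsymbol v)=\prod_h\Gamma(v_h)$ and $(\boldsymbol c)_{\boldsymbol m}=\prod_h(c_h)_{m_h}$, a scalar subscript being applied to each component; empty products are $1$. ${}_sF_t(\boldsymbol\alpha;\boldsymbol\beta;z)=\sum_{k\ge0}\frac{(\boldsymbol\alpha)_k}{(\boldsymbol\beta)_k}\frac{z^k}{k!}$. $\mathbb T$: positively oriented unit circle. Parameters. $p,q\ge1$, $0\le r<q$, $\boldsymbol a\in\mathbb C^r$, $\boldsymbol b\in\mathbb C^q$, $\boldsymbol\kappa\in\mathbb C^p$. Regular means: $0\le r<q$, $b_j-b_h\notin\mathbb Z$ for $j\ne h$, and $\kappa_i-\kappa_h\notin\mathbb Z$ for $i\ne h$. A regular parameter tuple is admissible for a displayed expression if every Gamma factor occurring explicitly in it, and both Gamma factors $\Gamma(x+n)$, $\Gamma(x)$ defining each parameter-dependent Pochhammer quotient $(x)_n=\Gamma(x+n)/\Gamma(x)$ in it, are finite (so parameter-dependent Pochhammer symbols are nonzero); simultaneous admissibility means this for all the expressions involved. Pochhammer symbols with integer arguments independent of the parameters, such as $(-n_i+1)_k$, keep their usual finite-product meaning; their zeros produce the terminating sums. Weights. For $1\le j\le q$, $1\le i\le p$ and $z\ne0$, $$C_{j,i}(z)=\sum_{k\ge0}\frac{\Gamma((k+\kappa_i)\mathbf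 1_r+\boldsymbol a+\mathbf 1_r)}{\Gamma((k+\kappa_i)\mathbf 1_q+\boldsymbol b+\boldsymbol e_j+\mathbf 1_q)}z^{-k-1},$$ and $C(z)=[C_{j,i}(z)]$ is the corresponding $q\times p$ matrix. Near the diagonal: $|m_j-m_h|\le1$ for all $j,h$. Then $m_{\min}(\boldsymbol m)=\min_hm_h$, $j_{\min}(\boldsymbol m)=\min\{j:m_j=m_{\min}(\boldsymbol m)\}$, $m_{\max}(\boldsymbol m)=\max_hm_h$, $j_{\max}(\boldsymbol m)=\max\{j:m_j=m_{\max}(\boldsymbol m)\}$. Step-line and Gauss–Borel factor. For $N=da+s$ with $a\in\mathbb N_0$, $0\le s\le d-1$, $\boldsymbol\sigma_d(N)=a\mathbf 1_d+\sum_{\alpha=1}^{s}\boldsymbol e_\alpha$. Let $X_{[d]}(z)$ be the semi-infinite block column with blocks $I_d,\,zI_d,\,z^2I_d,\dots$, and let $\mathscr M=\oint_{\mathbb T}X_{[q]}(z)\,C(z)\,X_{[p]}(z)^{\mathsf T}\frac{\mathrm dz}{2\pi\mathrm i}$ be the moment matrix. Assuming its leading principal truncations are nonsingular, it has the Gauss–Borel factorization $\mathscr M=S^{-1}H\bar S^{-\mathsf T}$ with $S,\bar S$ lower unitriangular and $H$ diagonal. The $B$-vectors supplied by $S$ are the rows of $S\,X_{[q]}(z)$, indexed by $N=0,1,2,\dots$; the row of index $N$ is monic in the component $r_N$ determined by $\boldsymbol\sigma_q(N+1)-\boldsymbol\sigma_q(N)=\boldsymbol e_{r_N}$. *)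

theory Defs
  imports
    "HOL-Complex_Analysis.Complex_Analysis"
    "Jordan_Normal_Form.Determinant"
begin

(* A vector of length d is a function on nat of which only the values at 1, ..., d are
   used; all component indices are 1-based. *)

definition hypergeom :: "complex list \<Rightarrow> complex list \<Rightarrow> complex \<Rightarrow> complex" where
  "hypergeom \<alpha>s \<beta>s z = eval_fps (fps_hypergeo \<alpha>s \<beta>s 1) z"

(* Integral over the positively oriented unit circle against dz / (2 pi i). *)
definition circ_integral :: "(complex \<Rightarrow> complex) \<Rightarrow> complex" where
  "circ_integral f =
     contour_integral (circlepath 0 1) (\<lambda>z. f z / (2 * complex_of_real pi * \<i>))"

definition regular_params ::
    "nat \<Rightarrow> nat \<Rightarrow> nat \<Rightarrow> (nat \<Rightarrow> complex) \<Rightarrow> (nat \<Rightarrow> complex) \<Rightarrow> bool" where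
  "regular_params p q r b \<kappa> \<longleftrightarrow>
     r < q \<and>
     (\<forall>j\<in>{1..q}. \<forall>h\<in>{1..q}. j \<noteq> h \<longrightarrow> b j - b h \<notin> \<int>) \<and>
     (\<forall>i\<in>{1..p}. \<forall>h\<in>{1..p}. i \<noteq> h \<longrightarrow> \<kappa> i - \<kappa> h \<notin> \<int>)"

definition weight ::
    "nat \<Rightarrow> nat \<Rightarrow> (nat \<Rightarrow> complex) \<Rightarrow> (nat \<Rightarrow> complex) \<Rightarrow> (nat \<Rightarrow> complex) \<Rightarrow>
     nat \<Rightarrow> nat \<Rightarrow> complex \<Rightarrow> complex" where
  "weight q r a b \<kappa> j i z =
     (\<Sum>k. (\<Prod>h=1..r. Gamma (of_nat k + \<kappa> i + a h + 1)) /
          (\<Prod>h=1..q. Gamma (of_nat k + \<kappa> i + b h + of_bool (h = j) + 1)) *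
          z powi (- int k - 1))"


definition vec_size :: "nat \<Rightarrow> (nat \<Rightarrow> nat) \<Rightarrow> nat" where
  "vec_size d v = (\<Sum>i=1..d. v i)"

definition near_diagonal :: "nat \<Rightarrow> (nat \<Rightarrow> nat) \<Rightarrow> bool" where
  "near_diagonal q m \<longleftrightarrow> (\<forall>j\<in>{1..q}. \<forall>h\<in>{1..q}. \<bar>int (m j) - int (m h)\<bar> \<le> 1)"

definition m_min :: "nat \<Rightarrow> (nat \<Rightarrow> nat) \<Rightarrow> nat" where
  "m_min q m = Min (m ` {1..q})"

definition j_min :: "nat \<Rightarrow> (nat \<Rightarrow> nat) \<Rightarrow> nat" where
  "j_min q m = Min {j \<in> {1..q}. m j = m_min q m}"

definition m_max :: "nat \<Rightarrow> (nat \<Rightarrow> nat) \<Rightarrow> nat" where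
  "m_max q m = Max (m ` {1..q})"

definition j_max :: "nat \<Rightarrow> (nat \<Rightarrow> nat) \<Rightarrow> nat" where
  "j_max q m = Max {j \<in> {1..q}. m j = m_max q m}"


definition A_const ::
    "nat \<Rightarrow> nat \<Rightarrow> nat \<Rightarrow> (nat \<Rightarrow> complex) \<Rightarrow> (nat \<Rightarrow> complex) \<Rightarrow> (nat \<Rightarrow> complex) \<Rightarrow>
     (nat \<Rightarrow> nat) \<Rightarrow> (nat \<Rightarrow> nat) \<Rightarrow> nat \<Rightarrow> complex" where
  "A_const p q r a b \<kappa> n m i =
     (-1) ^ vec_size p n *
     ((\<Prod>h=1..q. Gamma (\<kappa> i + b h + 1)) / (\<Prod>h=1..r. Gamma (\<kappa> i + a h + 1))) *
     ((\<Prod>j=1..q. pochhammer (\<kappa> i + b j + 1) (m j)) /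
      ((-1) ^ (n i - 1) * fact (n i - 1) *
       (\<Prod>l\<in>{1..p}-{i}. pochhammer (\<kappa> i - \<kappa> l - of_nat (n l) + 1) (n l))))"

definition A_upper ::
    "nat \<Rightarrow> nat \<Rightarrow> (nat \<Rightarrow> complex) \<Rightarrow> (nat \<Rightarrow> complex) \<Rightarrow>
     (nat \<Rightarrow> nat) \<Rightarrow> (nat \<Rightarrow> nat) \<Rightarrow> nat \<Rightarrow> complex list" where
  "A_upper p q b \<kappa> n m i =
     [- of_nat (n i) + 1] @
     map (\<lambda>h. \<kappa> i + b h + of_nat (m h) + 1) [1..<q+1] @
     map (\<lambda>l. \<kappa> i - \<kappa> l - of_nat (n l) + 1) (filter (\<lambda>l. l \<noteq> i) [1..<p+1])"

definition A_lower ::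
    "nat \<Rightarrow> nat \<Rightarrow> (nat \<Rightarrow> complex) \<Rightarrow> (nat \<Rightarrow> complex) \<Rightarrow> nat \<Rightarrow> complex list" where
  "A_lower p r a \<kappa> i =
     map (\<lambda>h. \<kappa> i + a h + 1) [1..<r+1] @
     map (\<lambda>l. \<kappa> i - \<kappa> l + 1) (filter (\<lambda>l. l \<noteq> i) [1..<p+1])"

definition A_comp ::
    "nat \<Rightarrow> nat \<Rightarrow> nat \<Rightarrow> (nat \<Rightarrow> complex) \<Rightarrow> (nat \<Rightarrow> complex) \<Rightarrow> (nat \<Rightarrow> complex) \<Rightarrow>
     (nat \<Rightarrow> nat) \<Rightarrow> (nat \<Rightarrow> nat) \<Rightarrow> complex \<Rightarrow> nat \<Rightarrow> complex \<Rightarrow> complex" where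
  "A_comp p q r a b \<kappa> n m \<nu> i z =
     (if n i = 0 then 0
      else \<nu> * A_const p q r a b \<kappa> n m i *
           hypergeom (A_upper p q b \<kappa> n m i) (A_lower p r a \<kappa> i) z)"

definition nu_A ::
    "nat \<Rightarrow> nat \<Rightarrow> nat \<Rightarrow> (nat \<Rightarrow> complex) \<Rightarrow> (nat \<Rightarrow> complex) \<Rightarrow> (nat \<Rightarrow> complex) \<Rightarrow>
     (nat \<Rightarrow> nat) \<Rightarrow> (nat \<Rightarrow> nat) \<Rightarrow> complex" where
  "nu_A p q r a b \<kappa> n m =
     (let J = j_min q m; M = m_min q m in
      - ((\<Prod>i=1..p. pochhammer (\<kappa> i + b J + of_nat M + 1) (n i)) /
         ((\<Prod>h=1..r. pochhammer (a h - b J - of_nat M) M) *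
          (\<Prod>h\<in>{h\<in>{1..q}. m h = M + 1}. b h - b J))))"


(* Set to 0 for K >= m_H; this includes the convention pi_{j,0} = 0 when m_j = 0. *)
definition pi_coeff ::
    "nat \<Rightarrow> nat \<Rightarrow> (nat \<Rightarrow> complex) \<Rightarrow> (nat \<Rightarrow> complex) \<Rightarrow>
     (nat \<Rightarrow> nat) \<Rightarrow> (nat \<Rightarrow> nat) \<Rightarrow> nat \<Rightarrow> nat \<Rightarrow> complex" where
  "pi_coeff p q b \<kappa> n m H K =
     (if K < m H then
        - ((\<Prod>i=1..p. pochhammer (\<kappa> i + b H + of_nat K + 1) (n i)) /
           ((-1) ^ K * fact K * fact (m H - K - 1) *
            (\<Prod>I\<in>{1..q}-{H}. pochhammer (b I - b H - of_nat K) (m I))))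
      else 0)"

definition B_comp ::
    "nat \<Rightarrow> nat \<Rightarrow> nat \<Rightarrow> (nat \<Rightarrow> complex) \<Rightarrow> (nat \<Rightarrow> complex) \<Rightarrow> (nat \<Rightarrow> complex) \<Rightarrow>
     (nat \<Rightarrow> nat) \<Rightarrow> (nat \<Rightarrow> nat) \<Rightarrow> complex \<Rightarrow> nat \<Rightarrow> complex \<Rightarrow> complex" where
  "B_comp p q r a b \<kappa> n m \<nu> j z =
     (if m j = 0 then 0
      else \<nu> *
        (pi_coeff p q b \<kappa> n m j 0 +
         (\<Prod>h=1..r. pochhammer (a h - b j) 1) /
         (\<Prod>h\<in>{1..q}-{j}. pochhammer (b h - b j) 1) *
         (\<Sum>H=1..q. \<Sum>K=1..m H - 1.
            pi_coeff p q b \<kappa> n m H K *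
            ((\<Prod>h\<in>{1..q}-{j}. pochhammer (b h - (b H + of_nat K)) 1) /
             (\<Prod>h=1..r. pochhammer (a h - (b H + of_nat K)) 1)) *
            hypergeom
              ([1] @ map (\<lambda>h. b h - (b H + of_nat K) + 1 - of_bool (h = j)) [1..<q+1])
              (map (\<lambda>h. a h - (b H + of_nat K) + 1) [1..<r+1]) z)))"

definition nu_B ::
    "nat \<Rightarrow> nat \<Rightarrow> nat \<Rightarrow> (nat \<Rightarrow> complex) \<Rightarrow> (nat \<Rightarrow> complex) \<Rightarrow> (nat \<Rightarrow> complex) \<Rightarrow>
     (nat \<Rightarrow> nat) \<Rightarrow> (nat \<Rightarrow> nat) \<Rightarrow> complex" where
  "nu_B p q r a b \<kappa> n m =
     (let J = j_max q m; M = m_max q m in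
      - (((\<Prod>h=1..r. pochhammer (a h - b J - (of_nat M - 1)) M) *
          (\<Prod>h\<in>{h\<in>{1..q}. h \<noteq> J \<and> m h = M}. b h - b J)) /
         ((\<Prod>h=1..r. pochhammer (a h - b J) 1) *
          (\<Prod>i=1..p. pochhammer (\<kappa> i + b J + of_nat M) (n i)))))"


(* Admissibility: no Gamma factor sits at a pole, where the library would return 0.  For
   Pochhammer symbols this concerns both Gamma factors of (x)_n = Gamma (x+n) / Gamma x,
   also when n = 0.  Symbols whose argument is an integer independent of the parameters,
   such as those with b_H - (b_H + K), are exempt. *)

definition gamma_finite :: "complex \<Rightarrow> bool" where
  "gamma_finite x \<longleftrightarrow> x \<notin> \<int>\<^sub>\<le>\<^sub>0"

definition poch_adm :: "complex \<Rightarrow> nat \<Rightarrow> bool" where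
  "poch_adm x n \<longleftrightarrow> gamma_finite (x + of_nat n) \<and> gamma_finite x"

definition weight_admissible ::
    "nat \<Rightarrow> nat \<Rightarrow> nat \<Rightarrow> (nat \<Rightarrow> complex) \<Rightarrow> (nat \<Rightarrow> complex) \<Rightarrow> (nat \<Rightarrow> complex) \<Rightarrow> bool" where
  "weight_admissible p q r a b \<kappa> \<longleftrightarrow>
     (\<forall>i\<in>{1..p}. \<forall>j\<in>{1..q}. \<forall>k::nat.
        (\<forall>h\<in>{1..r}. gamma_finite (of_nat k + \<kappa> i + a h + 1)) \<and>
        (\<forall>h\<in>{1..q}. gamma_finite (of_nat k + \<kappa> i + b h + of_bool (h = j) + 1)))"

definition A_admissible ::
    "nat \<Rightarrow> nat \<Rightarrow> nat \<Rightarrow> (nat \<Rightarrow> complex) \<Rightarrow> (nat \<Rightarrow> complex) \<Rightarrow> (nat \<Rightarrow> complex) \<Rightarrow>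
     (nat \<Rightarrow> nat) \<Rightarrow> (nat \<Rightarrow> nat) \<Rightarrow> bool" where
  "A_admissible p q r a b \<kappa> n m \<longleftrightarrow>
     weight_admissible p q r a b \<kappa> \<and>
     (\<forall>i\<in>{1..p}. 1 \<le> n i \<longrightarrow>
        (\<forall>h\<in>{1..q}. gamma_finite (\<kappa> i + b h + 1) \<and>
                    poch_adm (\<kappa> i + b h + 1) (m h) \<and>
                    (\<forall>k. poch_adm (\<kappa> i + b h + of_nat (m h) + 1) k)) \<and>
        (\<forall>h\<in>{1..r}. gamma_finite (\<kappa> i + a h + 1) \<and>
                    (\<forall>k. poch_adm (\<kappa> i + a h + 1) k)) \<and>
        (\<forall>l\<in>{1..p}-{i}. poch_adm (\<kappa> i - \<kappa> l - of_nat (n l) + 1) (n l) \<and>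
                    (\<forall>k. poch_adm (\<kappa> i - \<kappa> l - of_nat (n l) + 1) k \<and>
                         poch_adm (\<kappa> i - \<kappa> l + 1) k))) \<and>
     (let J = j_min q m; M = m_min q m in
        (\<forall>i\<in>{1..p}. poch_adm (\<kappa> i + b J + of_nat M + 1) (n i)) \<and>
        (\<forall>h\<in>{1..r}. poch_adm (a h - b J - of_nat M) M))"

definition B_admissible ::
    "nat \<Rightarrow> nat \<Rightarrow> nat \<Rightarrow> (nat \<Rightarrow> complex) \<Rightarrow> (nat \<Rightarrow> complex) \<Rightarrow> (nat \<Rightarrow> complex) \<Rightarrow>
     (nat \<Rightarrow> nat) \<Rightarrow> (nat \<Rightarrow> nat) \<Rightarrow> bool" where
  "B_admissible p q r a b \<kappa> n m \<longleftrightarrow>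
     weight_admissible p q r a b \<kappa> \<and>
     (\<forall>H\<in>{1..q}. \<forall>K<m H.
        (\<forall>i\<in>{1..p}. poch_adm (\<kappa> i + b H + of_nat K + 1) (n i)) \<and>
        (\<forall>I\<in>{1..q}-{H}. poch_adm (b I - b H - of_nat K) (m I))) \<and>
     (\<forall>j\<in>{1..q}. 1 \<le> m j \<longrightarrow>
        (\<forall>h\<in>{1..r}. poch_adm (a h - b j) 1) \<and>
        (\<forall>h\<in>{1..q}-{j}. poch_adm (b h - b j) 1) \<and>
        (\<forall>H\<in>{1..q}. \<forall>K\<in>{1..m H - 1}.
           (\<forall>h\<in>{1..q}-{j}. h \<noteq> H \<longrightarrow> poch_adm (b h - (b H + of_nat K)) 1) \<and>
           (\<forall>h\<in>{1..r}. poch_adm (a h - (b H + of_nat K)) 1) \<and>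
           (\<forall>h\<in>{1..q}. h \<noteq> H \<longrightarrow>
              (\<forall>k. poch_adm (b h - (b H + of_nat K) + 1 - of_bool (h = j)) k)) \<and>
           (\<forall>h\<in>{1..r}. \<forall>k. poch_adm (a h - (b H + of_nat K) + 1) k))) \<and>
     (let J = j_max q m; M = m_max q m in
        (\<forall>h\<in>{1..r}. poch_adm (a h - b J - (of_nat M - 1)) M \<and> poch_adm (a h - b J) 1) \<and>
        (\<forall>i\<in>{1..p}. poch_adm (\<kappa> i + b J + of_nat M) (n i)))"


definition step_line :: "nat \<Rightarrow> nat \<Rightarrow> nat \<Rightarrow> nat" where
  "step_line d N i = N div d + (\<Sum>\<alpha>=1..N mod d. of_bool (i = \<alpha>))"

(* Scalar rows N = 0, 1, 2, ... and columns 1, ..., d of the block column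
   I_d, z I_d, z^2 I_d, ...: row N = d c + s lies in the block z^c I_d. *)
definition block_col :: "nat \<Rightarrow> complex \<Rightarrow> nat \<Rightarrow> nat \<Rightarrow> complex" where
  "block_col d z N j = (if j = N mod d + 1 then z ^ (N div d) else 0)"

definition moment_matrix ::
    "nat \<Rightarrow> nat \<Rightarrow> nat \<Rightarrow> (nat \<Rightarrow> complex) \<Rightarrow> (nat \<Rightarrow> complex) \<Rightarrow> (nat \<Rightarrow> complex) \<Rightarrow>
     nat \<Rightarrow> nat \<Rightarrow> complex" where
  "moment_matrix p q r a b \<kappa> N L =
     circ_integral (\<lambda>z. \<Sum>j=1..q. \<Sum>i=1..p.
       block_col q z N j * weight q r a b \<kappa> j i z * block_col p z L i)"

definition truncations_nonsingular :: "(nat \<Rightarrow> nat \<Rightarrow> complex) \<Rightarrow> bool" where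
  "truncations_nonsingular M \<longleftrightarrow>
     (\<forall>N. Determinant.det (Matrix.mat N N (\<lambda>(k, l). M k l)) \<noteq> 0)"

definition lower_unitriangular :: "(nat \<Rightarrow> nat \<Rightarrow> complex) \<Rightarrow> bool" where
  "lower_unitriangular L \<longleftrightarrow> (\<forall>k. L k k = 1) \<and> (\<forall>k l. k < l \<longrightarrow> L k l = 0)"

definition diagonal_matrix :: "(nat \<Rightarrow> nat \<Rightarrow> complex) \<Rightarrow> bool" where
  "diagonal_matrix D \<longleftrightarrow> (\<forall>k l. k \<noteq> l \<longrightarrow> D k l = 0)"

(* Semi-infinite matrix product; used only with a lower triangular left factor, for which
   the sum over l stops at l = k. *)
definition ltri_mult ::
    "(nat \<Rightarrow> nat \<Rightarrow> complex) \<Rightarrow> (nat \<Rightarrow> nat \<Rightarrow> complex) \<Rightarrow> nat \<Rightarrow> nat \<Rightarrow> complex" where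
  "ltri_mult L X k j = (\<Sum>l\<le>k. L k l * X l j)"

definition ltri_inverse :: "(nat \<Rightarrow> nat \<Rightarrow> complex) \<Rightarrow> (nat \<Rightarrow> nat \<Rightarrow> complex) \<Rightarrow> bool" where
  "ltri_inverse L L' \<longleftrightarrow>
     lower_unitriangular L' \<and>
     ltri_mult L L' = (\<lambda>k l. of_bool (k = l)) \<and>
     ltri_mult L' L = (\<lambda>k l. of_bool (k = l))"

(* M = S^{-1} H Sbar^{-T} *)
definition gauss_borel ::
    "(nat \<Rightarrow> nat \<Rightarrow> complex) \<Rightarrow> (nat \<Rightarrow> nat \<Rightarrow> complex) \<Rightarrow> (nat \<Rightarrow> nat \<Rightarrow> complex) \<Rightarrow>
     (nat \<Rightarrow> nat \<Rightarrow> complex) \<Rightarrow> bool" where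
  "gauss_borel M S H Sb \<longleftrightarrow>
     lower_unitriangular S \<and> lower_unitriangular Sb \<and> diagonal_matrix H \<and>
     (\<exists>S' Sb'. ltri_inverse S S' \<and> ltri_inverse Sb Sb' \<and>
        M = ltri_mult S' (ltri_mult H (\<lambda>k l. Sb' l k)))"

end

(*
  Since C_{j,i} has moments c_j(k + kappa_i) with
  c_j(s) = Gamma(s + a + 1) / Gamma(s + b + e_j + 1), every circle integral is a finite sum of
  values of c_j.

  For A, the k-th coefficient of A^(i) is Gamma(s + b + m + 1)/Gamma(s + a + 1) at
  s = kappa_i + k times the residue there of 1 / prod_l (kappa_l - s)_{n_l}.  After multiplication by c_j(s + l) the Gamma quotients become a
  polynomial in s, because l <= m_h for all h near the diagonal.  Its degree is at most |n| - 2, so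
  the residues sum to zero; for l = m_min and j = j_min one linear factor
  1/(s + b_j + m_min + 1) remains and the sum is a partial fraction expansion evaluated at the pole
  of that factor.

  For B, the numbers -pi_{H,K} are the residues of
  G(s) = prod_i (kappa_i - s)_{n_i} / prod_h (s + b_h + 1)_{m_h}, which vanishes at
  s = kappa_i + l for l < n_i.  The hypergeometric terms telescope: against the weights, the
  summand belonging to (H,K) contributes exactly pi_{H,K} / (s + b_H + K + 1), by Lagrange
  interpolation of prod_h (y + a_h) at the nodes -b_j.  Hence the total is a multiple of G(s).

  On the step line the coefficients of B form a row with last entry 1 that is orthogonal to the
  earlier columns of the moment matrix; nonsingular truncations make such a row unique.
*)
theory Submission
  imports Defs
begin

section \<open>Interpolation and partial fractions\<close>

text \<open>One pole computation serves both families: \<open>node_deriv\<close> is the derivative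
  of prod_l (y + c_l)_{n_l} at a zero, with c = \<kappa> for A and c = b for B. The variable y is -s
  for A and s + 1 for B, hence the linear factors of slope -1.

  The telescoping for B has the following source. Put x = b_H + K, X = k - x and Y = s + 1 + k.
  Consecutive terms differ by a rational factor in X and Y, and Y - X = s + 1 + x does not depend on
  k. A Christoffel-Darboux type identity, a consequence of the interpolation, extracts exactly this
  difference; dividing by it leaves the simple pole. The chain runs from 1 to 0 because (-K)_k = 0
  for k > K.

  Closeness to the diagonal also bounds the degrees of B: for H \<noteq> j a pair (H,K) reaches
  component j only in degrees below K, and K < m_H \<le> m_j + 1. The inequality r < q makes the
  weights converge on the circle and leaves the interpolated polynomial of degree below the number
  of nodes.\<close>

lemma lagrange_interpolation:
  fixes x :: "'i \<Rightarrow> 'a :: field" and P :: "'a poly"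
  assumes "finite I" "inj_on x I" "degree P < card I"
  shows "poly P y = (\<Sum>i\<in>I. poly P (x i) * (\<Prod>j\<in>I-{i}. (y - x j) / (x i - x j)))"
proof -
  define Q where "Q = (\<Sum>i\<in>I. Polynomial.smult (poly P (x i) / (\<Prod>j\<in>I-{i}. x i - x j)) (\<Prod>j\<in>I-{i}. [:- x j, 1:]))"
  have Q: "poly Q y = (\<Sum>i\<in>I. poly P (x i) * (\<Prod>j\<in>I-{i}. (y - x j) / (x i - x j)))" for y
    unfolding Q_def poly_sum poly_smult poly_prod prod_dividef by simp
  have "P = Q"
  proof (rule poly_eqI_degree)
    fix z assume "z \<in> x ` I"
    then obtain k where k: "k \<in> I" "z = x k" by blast
    have "poly Q z = (\<Sum>i\<in>I. if i = k then poly P z else 0)"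
      unfolding Q
    proof (rule sum.cong [OF refl])
      fix i assume i: "i \<in> I"
      show "poly P (x i) * (\<Prod>j\<in>I-{i}. (z - x j) / (x i - x j)) = (if i = k then poly P z else 0)"
      proof (cases "i = k")
        case True
        have "x k \<noteq> x j" if "j \<in> I - {k}" for j
          using that k assms(2) by (auto dest: inj_onD)
        then have "(\<Prod>j\<in>I-{k}. (x k - x j) / (x k - x j)) = (\<Prod>j\<in>I-{k}. 1)"
          by (intro prod.cong) auto
        then show ?thesis using True k by simp
      next
        case False
        then have "(\<Prod>j\<in>I-{i}. (z - x j) / (x i - x j)) = 0"
          using k assms(1) by (intro prod_zero) auto
        then show ?thesis using False by simp
      qed
    qed
    then show "poly P z = poly Q z" using k assms(1) by simp
  next
    show "degree P < card (x ` I)" using assms by (simp add: card_image)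
    have "degree Q \<le> card I - 1"
      unfolding Q_def
    proof (rule degree_sum_le [OF assms(1)])
      fix i assume i: "i \<in> I"
      have "degree (\<Prod>j\<in>I-{i}. [:- x j, 1:]) \<le> (\<Sum>j\<in>I-{i}. 1)"
        using degree_prod_sum_le [of "I-{i}" "\<lambda>j. [:- x j, 1:]"] assms(1) by (simp add: o_def)
      also have "\<dots> = card I - 1" using i assms(1) by simp
      finally show "degree (Polynomial.smult (poly P (x i) / (\<Prod>j\<in>I-{i}. x i - x j)) (\<Prod>j\<in>I-{i}. [:- x j, 1:])) \<le> card I - 1"
        by (rule le_trans [OF degree_smult_le])
    qed
    then show "degree Q < card (x ` I)" using assms by (simp add: card_image)
  qed
  then have "poly P y = poly Q y" by (rule arg_cong)
  then show ?thesis unfolding Q .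
qed

lemma partial_fractions:
  fixes x :: "'i \<Rightarrow> 'a :: field" and P :: "'a poly"
  assumes "finite I" "inj_on x I" "degree P < card I" "y \<notin> x ` I"
  shows "poly P y / (\<Prod>i\<in>I. y - x i) =
         (\<Sum>i\<in>I. poly P (x i) / ((\<Prod>j\<in>I-{i}. x i - x j) * (y - x i)))"
proof -
  have nz: "(\<Prod>i\<in>I. y - x i) \<noteq> 0" using assms(1,4) by (subst prod_zero_iff) auto
  show ?thesis
    unfolding lagrange_interpolation [OF assms(1-3), of y] sum_divide_distrib
  proof (rule sum.cong [OF refl])
    fix i assume i: "i \<in> I"
    have "(\<Prod>i\<in>I. y - x i) = (y - x i) * (\<Prod>j\<in>I-{i}. y - x j)"
      using i assms(1) by (simp add: prod.remove)
    then show "poly P (x i) * (\<Prod>j\<in>I-{i}. (y - x j) / (x i - x j)) / (\<Prod>i\<in>I. y - x i) =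
               poly P (x i) / ((\<Prod>j\<in>I-{i}. x i - x j) * (y - x i))"
      using nz by (simp add: prod_dividef)
  qed
qed

text \<open>Partial fractions for P times (X - y), with y any point off the nodes: the value at y is
  0, and each factor x_i - y cancels its pole up to sign. This auxiliary factor is why the degree
  bound is stricter by one than in \<open>partial_fractions\<close>.\<close>

lemma sum_residues_zero:
  fixes x :: "'i \<Rightarrow> 'a :: field_char_0" and P :: "'a poly"
  assumes "finite I" "inj_on x I" "degree P + 1 < card I"
  shows "(\<Sum>i\<in>I. poly P (x i) / (\<Prod>j\<in>I-{i}. x i - x j)) = 0"
proof -
  obtain y where y: "y \<notin> x ` I"
    using ex_new_if_finite [OF infinite_UNIV_char_0, of "x ` I"] assms(1) by auto
  have "degree (P * [:- y, 1:]) \<le> degree P + 1"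
    using degree_mult_le [of P "[:- y, 1:]"] by simp
  then have "degree (P * [:- y, 1:]) < card I" using assms(3) by simp
  from partial_fractions [OF assms(1,2) this y]
  have "0 = (\<Sum>i\<in>I. poly P (x i) * (x i - y) / ((\<Prod>j\<in>I-{i}. x i - x j) * (y - x i)))"
    by (simp add: algebra_simps)
  also have "\<dots> = (\<Sum>i\<in>I. - (poly P (x i) / (\<Prod>j\<in>I-{i}. x i - x j)))"
  proof (rule sum.cong [OF refl])
    fix i assume "i \<in> I"
    then have "y - x i \<noteq> 0" using y by auto
    moreover have "x i - y = - (y - x i)" by simp
    ultimately show "poly P (x i) * (x i - y) / ((\<Prod>j\<in>I-{i}. x i - x j) * (y - x i)) =
                     - (poly P (x i) / (\<Prod>j\<in>I-{i}. x i - x j))"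
      by (metis (no_types, lifting) minus_divide_left mult_minus_right nonzero_mult_divide_mult_cancel_right)
  qed
  finally show ?thesis by (simp add: sum_negf)
qed

section \<open>Nodes in arithmetic progressions\<close>

lemma prod_int_shift_except:
  assumes "k < n"
  shows "(\<Prod>t\<in>{..<n}-{k}. of_nat t - of_nat k :: 'a :: field_char_0) =
         (-1) ^ k * fact k * fact (n - k - 1)"
proof -
  have split: "{..<n} - {k} = {..<k} \<union> {Suc k..<n}" using assms by auto
  have 1: "(\<Prod>t<k. of_nat t - of_nat k :: 'a) = (-1) ^ k * fact k"
    using pochhammer_same [of k, where ?'a = 'a]
    by (simp add: pochhammer_prod atLeast0LessThan add.commute)
  have "(\<Prod>t\<in>{Suc k..<n}. of_nat t - of_nat k :: 'a) = (\<Prod>t\<in>{0..<n - k - 1}. of_nat (Suc t))"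
    by (rule prod.reindex_bij_witness [of _ "\<lambda>t. t + Suc k" "\<lambda>t. t - Suc k"])
       (use assms in \<open>auto simp: of_nat_diff algebra_simps\<close>)
  also have "\<dots> = fact (n - k - 1)"
    by (simp add: fact_prod_Suc)
  finally have 2: "(\<Prod>t\<in>{Suc k..<n}. of_nat t - of_nat k :: 'a) = fact (n - k - 1)" .
  show ?thesis unfolding split
    by (subst prod.union_disjoint) (auto simp: 1 2)
qed

text \<open>Derivative of prod_l (y + c_l)_{n_l} at its zero y = -(c_i + k). The signed factorials
  come from the other zeros of the same progression, the Pochhammer symbols from the other
  progressions. For c = b it is the denominator of \<pi>_{H,K}.\<close>

definition node_deriv :: "'i set \<Rightarrow> ('i \<Rightarrow> complex) \<Rightarrow> ('i \<Rightarrow> nat) \<Rightarrow> 'i \<Rightarrow> nat \<Rightarrow> complex" where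
  "node_deriv I c n i k =
     (-1) ^ k * fact k * fact (n i - k - 1) * (\<Prod>l\<in>I-{i}. pochhammer (c l - c i - of_nat k) (n l))"

lemma node_deriv_eq:
  assumes "finite I" "i \<in> I" "k < n i"
  shows "(\<Prod>(l, t)\<in>Sigma I (\<lambda>l. {..<n l}) - {(i, k)}. (c l + of_nat t) - (c i + of_nat k)) =
         node_deriv I c n i k"
proof -
  have split: "Sigma I (\<lambda>l. {..<n l}) - {(i, k)} =
        Pair i ` ({..<n i} - {k}) \<union> Sigma (I-{i}) (\<lambda>l. {..<n l})"
    using assms by auto
  have 1: "(\<Prod>(l, t)\<in>Pair i ` ({..<n i} - {k}). (c l + of_nat t) - (c i + of_nat k)) =
         (-1) ^ k * fact k * fact (n i - k - 1)"
    by (subst prod.reindex) (auto simp: inj_on_def prod_int_shift_except [OF assms(3)])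
  have 2: "(\<Prod>(l, t)\<in>Sigma (I-{i}) (\<lambda>l. {..<n l}). (c l + of_nat t) - (c i + of_nat k)) =
         (\<Prod>l\<in>I-{i}. pochhammer (c l - c i - of_nat k) (n l))"
    using assms(1) by (subst prod.Sigma [symmetric])
      (auto simp: pochhammer_prod atLeast0LessThan algebra_simps)
  show ?thesis unfolding split node_deriv_def using assms(1)
    by (subst prod.union_disjoint) (auto simp: 1 2)
qed

lemma inj_on_nodes:
  fixes c :: "'i \<Rightarrow> complex"
  assumes "\<And>i j. i \<in> I \<Longrightarrow> j \<in> I \<Longrightarrow> i \<noteq> j \<Longrightarrow> c i - c j \<notin> \<int>"
  shows "inj_on (\<lambda>(l, t). - (c l + of_nat t)) (Sigma I (\<lambda>l. {..<n l}))"
proof (rule inj_onI, clarify)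
  fix i k l t
  assume *: "i \<in> I" "l \<in> I" "- (c i + of_nat k) = - (c l + of_nat t)"
  have "c i - c l = of_nat t - of_nat k" using *(3) by (simp add: algebra_simps)
  then have "c i - c l \<in> \<int>" by simp
  then have "i = l" using assms * by blast
  then show "i = l \<and> k = t" using * by simp
qed

text \<open>The nodes are distinct because the differences of the c_i are not integers, and y avoids
  them because no Pochhammer symbol in the denominator vanishes.\<close>

lemma pochhammer_partial_fractions:
  fixes c :: "'i \<Rightarrow> complex" and P :: "complex poly"
  assumes "finite I" and c: "\<And>i j. i \<in> I \<Longrightarrow> j \<in> I \<Longrightarrow> i \<noteq> j \<Longrightarrow> c i - c j \<notin> \<int>"
    and deg: "degree P < (\<Sum>i\<in>I. n i)"
    and y: "\<And>i. i \<in> I \<Longrightarrow> pochhammer (y + c i) (n i) \<noteq> 0"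
  shows "poly P y / (\<Prod>i\<in>I. pochhammer (y + c i) (n i)) =
         (\<Sum>i\<in>I. \<Sum>k<n i. poly P (- (c i + of_nat k)) /
            (node_deriv I c n i k * (y + (c i + of_nat k))))"
proof -
  let ?S = "Sigma I (\<lambda>l. {..<n l})" and ?x = "\<lambda>(l, t). - (c l + of_nat t)"
  have fin: "finite ?S" using assms(1) by auto
  have card: "card ?S = (\<Sum>i\<in>I. n i)" using assms(1) by simp
  have ynot: "y \<notin> ?x ` ?S"
  proof
    assume "y \<in> ?x ` ?S"
    then obtain l t where lt: "l \<in> I" "t < n l" "y = - (c l + of_nat t)" by auto
    then have "pochhammer (y + c l) (n l) = 0"
      by (auto simp: pochhammer_eq_0_iff)
    then show False using y lt by blast
  qed
  have D: "(\<Prod>s\<in>?S. y - ?x s) = (\<Prod>i\<in>I. pochhammer (y + c i) (n i))"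
  proof -
    have "(\<Prod>s\<in>?S. y - ?x s) = (\<Prod>(i,k)\<in>?S. y + c i + of_nat k)"
      by (rule prod.cong [OF refl]) auto
    also have "\<dots> = (\<Prod>i\<in>I. \<Prod>k<n i. y + c i + of_nat k)"
      using assms(1) by (subst prod.Sigma) auto
    finally show ?thesis by (simp add: pochhammer_prod atLeast0LessThan)
  qed
  have E: "(\<Prod>s\<in>?S - {(i, k)}. ?x (i, k) - ?x s) = node_deriv I c n i k" if "i \<in> I" "k < n i" for i k
    unfolding node_deriv_eq [of I i k n c, OF assms(1) that, symmetric]
    by (rule prod.cong [OF refl]) auto
  have "poly P y / (\<Prod>s\<in>?S. y - ?x s) =
     (\<Sum>s\<in>?S. poly P (?x s) / ((\<Prod>j\<in>?S-{s}. ?x s - ?x j) * (y - ?x s)))"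
    by (rule partial_fractions [OF fin inj_on_nodes [OF c] _ ynot]) (use deg card in auto)
  also have "\<dots> = (\<Sum>(i,k)\<in>?S. poly P (- (c i + of_nat k)) /
            (node_deriv I c n i k * (y + (c i + of_nat k))))"
    by (rule sum.cong [OF refl]) (auto simp: E [simplified])
  also have "\<dots> = (\<Sum>i\<in>I. \<Sum>k<n i. poly P (- (c i + of_nat k)) /
            (node_deriv I c n i k * (y + (c i + of_nat k))))"
    using assms(1) by (subst sum.Sigma) auto
  finally show ?thesis unfolding D .
qed

lemma pochhammer_sum_residues_zero:
  fixes c :: "'i \<Rightarrow> complex" and P :: "complex poly"
  assumes "finite I" and c: "\<And>i j. i \<in> I \<Longrightarrow> j \<in> I \<Longrightarrow> i \<noteq> j \<Longrightarrow> c i - c j \<notin> \<int>"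
    and deg: "degree P + 1 < (\<Sum>i\<in>I. n i)"
  shows "(\<Sum>i\<in>I. \<Sum>k<n i. poly P (- (c i + of_nat k)) / node_deriv I c n i k) = 0"
proof -
  let ?S = "Sigma I (\<lambda>l. {..<n l})" and ?x = "\<lambda>(l, t). - (c l + of_nat t)"
  have fin: "finite ?S" using assms(1) by auto
  have card: "card ?S = (\<Sum>i\<in>I. n i)" using assms(1) by simp
  have E: "(\<Prod>s\<in>?S - {(i, k)}. ?x (i, k) - ?x s) = node_deriv I c n i k" if "i \<in> I" "k < n i" for i k
    unfolding node_deriv_eq [of I i k n c, OF assms(1) that, symmetric]
    by (rule prod.cong [OF refl]) auto
  have "0 = (\<Sum>s\<in>?S. poly P (?x s) / (\<Prod>j\<in>?S-{s}. ?x s - ?x j))"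
    by (rule sum_residues_zero [OF fin inj_on_nodes [OF c], symmetric]) (use deg card in auto)
  also have "\<dots> = (\<Sum>(i,k)\<in>?S. poly P (- (c i + of_nat k)) / node_deriv I c n i k)"
    by (rule sum.cong [OF refl]) (auto simp: E [simplified])
  also have "\<dots> = (\<Sum>i\<in>I. \<Sum>k<n i. poly P (- (c i + of_nat k)) / node_deriv I c n i k)"
    using assms(1) by (subst sum.Sigma) auto
  finally show ?thesis by simp
qed

section \<open>Pochhammer symbols in the polynomial ring\<close>

lemma poly_pochhammer: "poly (pochhammer P n) x = pochhammer (poly P x) n"
  by (simp add: pochhammer_prod poly_prod)

lemma degree_pochhammer_linear_le:
  fixes u v :: "'a :: comm_ring_1"
  shows "degree (pochhammer [:u, v:] n) \<le> n"
proof -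
  have "degree (pochhammer [:u, v:] n) \<le> (\<Sum>i\<in>{0..<n}. degree ([:u, v:] + of_nat i))"
    unfolding pochhammer_prod by (rule degree_prod_sum_le [unfolded o_def]) simp
  also have "\<dots> \<le> (\<Sum>i\<in>{0..<n}. 1)"
    by (intro sum_mono degree_add_le) (auto simp: of_nat_poly)
  finally show ?thesis by simp
qed

lemma degree_prod_le_sum:
  assumes "finite A" "\<And>i. i \<in> A \<Longrightarrow> degree (f i) \<le> g i"
  shows "degree (\<Prod>i\<in>A. f i :: 'a :: comm_semiring_1 poly) \<le> (\<Sum>i\<in>A. g i)"
  using degree_prod_sum_le [OF assms(1), of f] sum_mono [of A "\<lambda>i. degree (f i)" g] assms(2)
  by (simp add: o_def)

section \<open>Moments of the weights\<close>

lemma has_contour_integral_powi_circlepath: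
  "((\<lambda>z. z powi e) has_contour_integral (if e = -1 then 2 * complex_of_real pi * \<i> else 0))
     (circlepath 0 1)"
proof (cases "e = -1")
  case True
  have int: "(\<lambda>z. 1 / (z - 0)) contour_integrable_on circlepath 0 1"
    by (rule contour_integrable_continuous_circlepath) (auto intro!: continuous_intros)
  have val: "contour_integral (circlepath 0 1) (\<lambda>z. 1 / (z - 0)) = 2 * complex_of_real pi * \<i>"
    by (rule contour_integral_circlepath) simp
  have "((\<lambda>z. 1 / (z - 0)) has_contour_integral (2 * complex_of_real pi * \<i>)) (circlepath 0 1)"
    using has_contour_integral_integral [OF int] unfolding val .
  then show ?thesis using True by (simp add: power_int_minus_divide)
next
  case False
  have "((\<lambda>z. z powi e) has_contour_integral 0) (circlepath 0 1)"
  proof (rule Cauchy_theorem_primitive)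
    show "((\<lambda>z. z powi (e + 1) / of_int (e + 1)) has_field_derivative z powi e) (at z within - {0})"
      if "z \<in> - {0}" for z :: complex
    proof -
      have "of_int (e + 1) \<noteq> (0 :: complex)" using False by (subst of_int_eq_0_iff) linarith
      then show ?thesis using that
        by (auto intro!: derivative_eq_intros)
    qed
  qed auto
  then show ?thesis using False by simp
qed

text \<open>Absolute summability makes the partial sums converge uniformly on the unit circle, so
  integration is termwise; only the exponent -1, that is k = l, survives.\<close>

lemma has_contour_integral_laurent_tail:
  fixes w :: "nat \<Rightarrow> complex"
  assumes "summable (\<lambda>k. norm (w k))"
  shows "((\<lambda>z. z ^ l * (\<Sum>k. w k * z powi (- int k - 1)))
           has_contour_integral 2 * complex_of_real pi * \<i> * w l) (circlepath 0 1)"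
proof -
  define f where "f = (\<lambda>n z. \<Sum>k<n. w k * z powi (int l - int k - 1))"
  let ?g = "\<lambda>z. \<Sum>k. w k * z powi (int l - int k - 1)"
  have ul: "uniform_limit (sphere 0 1) f ?g sequentially"
    unfolding f_def
    by (rule Weierstrass_m_test [OF _ assms]) (auto simp: norm_mult norm_power_int)
  have int_n: "(f n has_contour_integral
       (\<Sum>k<n. w k * (if int l - int k - 1 = -1 then 2 * complex_of_real pi * \<i> else 0))) (circlepath 0 1)" for n
    unfolding f_def
    by (intro has_contour_integral_sum has_contour_integral_lmul has_contour_integral_powi_circlepath) simp
  have ev: "\<forall>\<^sub>F n in sequentially. f n contour_integrable_on circlepath 0 1"
    by (intro always_eventually allI) (rule has_contour_integral_integrable [OF int_n])
  have g: "?g contour_integrable_on circlepath 0 1"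
    and lim: "(\<lambda>n. contour_integral (circlepath 0 1) (f n)) \<longlonglongrightarrow> contour_integral (circlepath 0 1) ?g"
    using contour_integral_uniform_limit_circlepath [OF ev ul] by auto
  have "contour_integral (circlepath 0 1) (f n) = 2 * complex_of_real pi * \<i> * w l" if "n > l" for n
  proof -
    have "contour_integral (circlepath 0 1) (f n) =
        (\<Sum>k<n. if k = l then w l * (2 * complex_of_real pi * \<i>) else 0)"
      unfolding contour_integral_unique [OF int_n]
      by (rule sum.cong) auto
    then show ?thesis using that by simp
  qed
  then have "(\<lambda>n. contour_integral (circlepath 0 1) (f n)) \<longlonglongrightarrow> 2 * complex_of_real pi * \<i> * w l"
    by (intro tendsto_eventually eventually_sequentiallyI [of "Suc l"]) auto
  then have "contour_integral (circlepath 0 1) ?g = 2 * complex_of_real pi * \<i> * w l"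
    using lim by (rule LIMSEQ_unique [symmetric])
  with has_contour_integral_integral [OF g]
  have "(?g has_contour_integral 2 * complex_of_real pi * \<i> * w l) (circlepath 0 1)" by simp
  then show ?thesis
  \<comment> \<open>The limit was computed with z^l inside the series. On the circle the series
    converges and z is nonzero, so the power may be pulled out.\<close>
  proof (rule has_contour_integral_eq)
    fix z assume "z \<in> path_image (circlepath 0 1 :: real \<Rightarrow> complex)"
    then have z: "norm z = 1" by simp
    then have "z \<noteq> 0" by auto
    have "summable (\<lambda>k. w k * z powi (- int k - 1))"
      by (rule summable_norm_cancel) (simp add: norm_mult norm_power_int z assms)
    then have "z ^ l * (\<Sum>k. w k * z powi (- int k - 1)) = (\<Sum>k. z ^ l * (w k * z powi (- int k - 1)))"
      by (rule suminf_mult [symmetric])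
    also have "\<dots> = ?g z"
    proof (rule suminf_cong)
      fix k
      have "z powi (int l - int k - 1) = z powi (int l + (- int k - 1))"
        by (rule arg_cong [where f = "\<lambda>e. z powi e"]) simp
      also have "\<dots> = z ^ l * z powi (- int k - 1)"
        using \<open>z \<noteq> 0\<close> by (subst power_int_add) auto
      finally show "z ^ l * (w k * z powi (- int k - 1)) = w k * z powi (int l - int k - 1)"
        by simp
    qed
    finally show "?g z = z ^ l * (\<Sum>k. w k * z powi (- int k - 1))" ..
  qed
qed

lemma circ_integral_laurent_tail:
  fixes w :: "nat \<Rightarrow> complex"
  assumes "summable (\<lambda>k. norm (w k))"
  shows "circ_integral (\<lambda>z. z ^ l * (\<Sum>k. w k * z powi (- int k - 1)) * (\<Sum>k<d. c k * z ^ k)) =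
         (\<Sum>k<d. c k * w (k + l))"
proof -
  let ?W = "\<lambda>z. \<Sum>k. w k * z powi (- int k - 1)"
  have *: "((\<lambda>z. \<Sum>k<d. c k * (z ^ (k + l) * ?W z)) has_contour_integral
      (\<Sum>k<d. c k * (2 * complex_of_real pi * \<i> * w (k + l)))) (circlepath 0 1)"
    by (intro has_contour_integral_sum has_contour_integral_lmul
        has_contour_integral_laurent_tail assms) simp
  have eq: "c k * (2 * complex_of_real pi * \<i> * w (k + l)) / (2 * complex_of_real pi * \<i>) = c k * w (k + l)" for k
    by (simp add: field_simps)
  from has_contour_integral_div [OF *, of "2 * complex_of_real pi * \<i>"]
  have "((\<lambda>z. (\<Sum>k<d. c k * (z ^ (k + l) * ?W z)) / (2 * complex_of_real pi * \<i>)) has_contour_integral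
      (\<Sum>k<d. c k * w (k + l))) (circlepath 0 1)"
    by (simp only: sum_divide_distrib [of _ "{..<d}"] eq)
  moreover have "(\<Sum>k<d. c k * (z ^ (k + l) * ?W z)) = z ^ l * ?W z * (\<Sum>k<d. c k * z ^ k)" for z
    by (simp add: sum_distrib_left sum_distrib_right power_add mult_ac)
  ultimately show ?thesis
    unfolding circ_integral_def by (intro contour_integral_unique) simp
qed

text \<open>The moment function c_j(s) of the overview. It is kept as a function of a complex s
  because the moments are its values along the progressions \<kappa>_i + k, the nodes of the
  interpolation.\<close>

definition wcoef ::
    "nat \<Rightarrow> nat \<Rightarrow> (nat \<Rightarrow> complex) \<Rightarrow> (nat \<Rightarrow> complex) \<Rightarrow> nat \<Rightarrow> complex \<Rightarrow> complex" where
  "wcoef q r a b j s =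
     (\<Prod>h=1..r. Gamma (s + a h + 1)) / (\<Prod>h=1..q. Gamma (s + b h + of_bool (h = j) + 1))"

lemma weight_eq_wcoef:
  "weight q r a b \<kappa> j i z = (\<Sum>k. wcoef q r a b j (of_nat k + \<kappa> i) * z powi (- int k - 1))"
  by (simp add: weight_def wcoef_def)

section \<open>Absolute convergence of the weights on the circle\<close>

lemma tendsto_shift_quotient: "(\<lambda>k. (of_nat k + \<alpha>) / (of_nat k + \<beta>) :: complex) \<longlonglongrightarrow> 1"
  and tendsto_inverse_shift: "(\<lambda>k. 1 / (of_nat k + \<beta>) :: complex) \<longlonglongrightarrow> 0"
proof -
  have inf: "filterlim (\<lambda>k. of_nat k + \<beta> :: complex) at_infinity sequentially"
    by (rule tendsto_add_filterlim_at_infinity' [OF tendsto_of_nat tendsto_const])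
  then have 1: "(\<lambda>k. c / (of_nat k + \<beta>) :: complex) \<longlonglongrightarrow> 0" for c
    by (rule tendsto_divide_0 [OF tendsto_const])
  then show "(\<lambda>k. 1 / (of_nat k + \<beta>) :: complex) \<longlonglongrightarrow> 0" .
  have "(\<lambda>k. 1 + (\<alpha> - \<beta>) / (of_nat k + \<beta>) :: complex) \<longlonglongrightarrow> 1 + 0"
    by (intro tendsto_add tendsto_const 1)
  moreover have "\<forall>\<^sub>F k in sequentially. 1 + (\<alpha> - \<beta>) / (of_nat k + \<beta>) = (of_nat k + \<alpha>) / (of_nat k + \<beta>)"
    using filterlim_at_infinity_imp_eventually_ne [OF inf, of 0]
    by eventually_elim (simp add: field_simps)
  ultimately show "(\<lambda>k. (of_nat k + \<alpha>) / (of_nat k + \<beta>) :: complex) \<longlonglongrightarrow> 1"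
    using Lim_transform_eventually by fastforce
qed

text \<open>The first r factors pair up with limit 1; the unpaired denominators, at least one since
  r < q, force the limit 0.\<close>

lemma tendsto_prod_quotient_0:
  fixes \<alpha> \<beta> :: "nat \<Rightarrow> complex"
  assumes "r < q"
  shows "(\<lambda>k. (\<Prod>h=1..r. of_nat k + \<alpha> h) / (\<Prod>h=1..q. of_nat k + \<beta> h)) \<longlonglongrightarrow> 0"
proof -
  have split: "{1..q} = {1..r} \<union> {r<..q}" using assms by auto
  have "(\<lambda>k. (\<Prod>h=1..r. (of_nat k + \<alpha> h) / (of_nat k + \<beta> h)) *
             (\<Prod>h\<in>{r<..q}. 1 / (of_nat k + \<beta> h))) \<longlonglongrightarrow> (\<Prod>h=1..r. 1) * (\<Prod>h\<in>{r<..q}. 0 :: complex)"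
    by (intro tendsto_mult tendsto_prod tendsto_shift_quotient tendsto_inverse_shift)
  moreover have "(\<Prod>h\<in>{r<..q}. 0 :: complex) = 0" using assms by (intro prod_zero) auto
  moreover have "(\<Prod>h=1..q. of_nat k + \<beta> h) =
      (\<Prod>h=1..r. of_nat k + \<beta> h) * (\<Prod>h\<in>{r<..q}. of_nat k + \<beta> h)" for k
    unfolding split by (rule prod.union_disjoint) auto
  ultimately show ?thesis by (simp add: prod_dividef del: prod_constant)
qed

text \<open>Ratio test: by the Gamma recurrence consecutive terms differ by a quotient of r by q
  linear factors in k. Admissibility keeps every argument off the poles, where the recurrence would
  fail.\<close>

lemma summable_wcoef:
  assumes "r < q" "weight_admissible p q r a b \<kappa>" "i \<in> {1..p}" "j \<in> {1..q}"
  shows "summable (\<lambda>k. norm (wcoef q r a b j (of_nat k + \<kappa> i)))"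
proof -
  let ?w = "\<lambda>k. wcoef q r a b j (of_nat k + \<kappa> i)"
  define \<alpha> where "\<alpha> h = \<kappa> i + a h + 1" for h
  define \<beta> where "\<beta> h = \<kappa> i + b h + of_bool (h = j) + 1" for h
  let ?q = "\<lambda>k. (\<Prod>h=1..r. of_nat k + \<alpha> h) / (\<Prod>h=1..q. of_nat k + \<beta> h)"
  have adm: "of_nat k + \<alpha> h \<notin> \<int>\<^sub>\<le>\<^sub>0" if "h \<in> {1..r}" for k h
    using assms(2-4) that unfolding weight_admissible_def gamma_finite_def \<alpha>_def
    by (simp add: add.assoc)
  have bdm: "of_nat k + \<beta> h \<notin> \<int>\<^sub>\<le>\<^sub>0" if "h \<in> {1..q}" for k h
    using assms(2-4) that unfolding weight_admissible_def gamma_finite_def \<beta>_def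
    by (metis (no_types, lifting) add.assoc)
  have w: "?w k = (\<Prod>h=1..r. Gamma (of_nat k + \<alpha> h)) / (\<Prod>h=1..q. Gamma (of_nat k + \<beta> h))" for k
    by (simp add: wcoef_def \<alpha>_def \<beta>_def add.assoc)
  have rec: "?w (Suc k) = ?q k * ?w k" for k
  proof -
    have "Gamma (of_nat (Suc k) + \<alpha> h) = (of_nat k + \<alpha> h) * Gamma (of_nat k + \<alpha> h)" if "h \<in> {1..r}" for h
      using Gamma_plus1 [OF adm [OF that]] by (simp add: add_ac)
    moreover have "Gamma (of_nat (Suc k) + \<beta> h) = (of_nat k + \<beta> h) * Gamma (of_nat k + \<beta> h)" if "h \<in> {1..q}" for h
      using Gamma_plus1 [OF bdm [OF that]] by (simp add: add_ac)
    ultimately show ?thesis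
      unfolding w by (simp add: prod.distrib del: of_nat_Suc cong: prod.cong_simp)
  qed
  have "(\<lambda>k. norm (?q k)) \<longlonglongrightarrow> 0"
    using tendsto_prod_quotient_0 [OF assms(1)] tendsto_norm_zero by blast
  then have "\<forall>\<^sub>F k in sequentially. norm (?q k) < 1/2"
    by (rule order_tendstoD) simp
  then obtain N where N: "\<And>k. k \<ge> N \<Longrightarrow> norm (?q k) < 1/2"
    unfolding eventually_sequentially by blast
  show ?thesis
  proof (rule summable_ratio_test [of "1/2" N])
    fix k assume "k \<ge> N"
    then have "norm (?q k) * norm (?w k) \<le> 1/2 * norm (?w k)"
      using N [of k] by (intro mult_right_mono) auto
    then show "norm (norm (?w (Suc k))) \<le> 1/2 * norm (norm (?w k))"
      by (simp only: rec norm_mult real_norm_def abs_mult abs_norm_cancel)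
  qed simp
qed

lemma circ_integral_weight:
  assumes "r < q" "weight_admissible p q r a b \<kappa>" "i \<in> {1..p}" "j \<in> {1..q}"
  shows "circ_integral (\<lambda>z. z ^ l * weight q r a b \<kappa> j i z * (\<Sum>k<d. c k * z ^ k)) =
         (\<Sum>k<d. c k * wcoef q r a b j (of_nat (k + l) + \<kappa> i))"
  unfolding weight_eq_wcoef by (rule circ_integral_laurent_tail [OF summable_wcoef [OF assms]])

section \<open>The mixed polynomials A\<close>

lemma gamma_finite_add: "gamma_finite x \<Longrightarrow> gamma_finite (x + of_nat k)"
proof -
  have "x \<in> \<int>\<^sub>\<le>\<^sub>0" if nonpos: "x + of_nat k \<in> \<int>\<^sub>\<le>\<^sub>0"
  proof -
    obtain m where "x + of_nat k = - of_nat m"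
      using nonpos by (elim nonpos_Ints_cases') 
    then have "x = - of_nat m - of_nat k" by (simp only: eq_diff_eq)
    then have "x = - of_nat (m + k)" by simp
    then show ?thesis by (metis minus_of_nat_in_nonpos_Ints)
  qed
  then show "gamma_finite x \<Longrightarrow> gamma_finite (x + of_nat k)"
    unfolding gamma_finite_def by blast
qed

lemma gamma_finite_nonzero: "gamma_finite x \<Longrightarrow> Gamma x \<noteq> 0"
  by (simp add: gamma_finite_def Gamma_eq_zero_iff)

lemma gamma_finite_pochhammer_nonzero: "gamma_finite x \<Longrightarrow> pochhammer x n \<noteq> 0"
  by (auto simp: gamma_finite_def pochhammer_eq_0_iff)

lemma Gamma_mult_pochhammer: "gamma_finite x \<Longrightarrow> Gamma x * pochhammer x n = Gamma (x + of_nat n)"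
  by (simp add: gamma_finite_def pochhammer_Gamma Gamma_eq_zero_iff)

lemma pochhammer_nonzero_if_not_Int: "(x :: complex) \<notin> \<int> \<Longrightarrow> pochhammer x n \<noteq> 0"
  by (auto simp: pochhammer_eq_0_iff)

lemma fps_nth_hypergeo:
  "fps_nth (fps_hypergeo xs ys 1) k =
     (\<Prod>x\<leftarrow>xs. pochhammer x k) / ((\<Prod>y\<leftarrow>ys. pochhammer y k) * fact k)"
proof -
  have "foldl (\<lambda>r x. r * pochhammer x k) u xs = u * (\<Prod>x\<leftarrow>xs. pochhammer x k)" for u and xs :: "'a list"
    by (induction xs arbitrary: u) (simp_all add: mult_ac)
  then show ?thesis by simp
qed

lemma prod_list_map_upt: "(\<Prod>h\<leftarrow>[1..<d+1]. f h) = (\<Prod>h=1..d. f h :: 'a :: comm_monoid_mult)"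
  by (subst prod.distinct_set_conv_list [symmetric]) (auto intro!: prod.cong)

lemma prod_list_map_upt_filter:
  "(\<Prod>h\<leftarrow>filter (\<lambda>l. l \<noteq> i) [1..<d+1]. f h) = (\<Prod>h\<in>{1..d}-{i}. f h :: 'a :: comm_monoid_mult)"
  by (subst prod.distinct_set_conv_list [symmetric]) (auto intro!: prod.cong)

lemma hypergeom_terminating:
  assumes "\<And>k. k \<ge> d \<Longrightarrow> fps_nth (fps_hypergeo xs ys 1) k = 0"
  shows "hypergeom xs ys z = (\<Sum>k<d. fps_nth (fps_hypergeo xs ys 1) k * z ^ k)"
  unfolding hypergeom_def eval_fps_def
  by (rule suminf_finite) (simp_all add: assms not_less del: fps_hypergeo_nth)

lemma poly_of_coeffs:
  fixes c :: "nat \<Rightarrow> 'a :: comm_semiring_1"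
  obtains P where "degree P \<le> d - 1" "\<And>k. coeff P k = (if k < d then c k else 0)"
    "\<And>z. poly P z = (\<Sum>k<d. c k * z ^ k)"
proof
  let ?P = "\<Sum>k<d. Polynomial.monom (c k) k"
  show coeff: "coeff ?P k = (if k < d then c k else 0)" for k
    by (simp add: coeff_sum)
  show "degree ?P \<le> d - 1"
    by (rule degree_le) (auto simp: coeff)
  show "poly ?P z = (\<Sum>k<d. c k * z ^ k)" for z
    by (simp add: poly_sum poly_monom)
qed

lemma A_series_coeff:
  "fps_nth (fps_hypergeo (A_upper p q b \<kappa> n m i) (A_lower p r a \<kappa> i) 1) k =
     pochhammer (- of_nat (n i) + 1) k *
     (\<Prod>h=1..q. pochhammer (\<kappa> i + b h + of_nat (m h) + 1) k) *
     (\<Prod>l\<in>{1..p}-{i}. pochhammer (\<kappa> i - \<kappa> l - of_nat (n l) + 1) k) /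
     ((\<Prod>h=1..r. pochhammer (\<kappa> i + a h + 1) k) *
      (\<Prod>l\<in>{1..p}-{i}. pochhammer (\<kappa> i - \<kappa> l + 1) k) * fact k)"
  unfolding fps_nth_hypergeo A_upper_def A_lower_def
  by (simp only: map_append prod_list.append map_map o_def prod_list_map_upt prod_list_map_upt_filter)
     (simp add: mult.assoc)

lemma A_series_terminates:
  assumes "1 \<le> n i" "n i \<le> k"
  shows "fps_nth (fps_hypergeo (A_upper p q b \<kappa> n m i) (A_lower p r a \<kappa> i) 1) k = 0"
proof -
  have "pochhammer (- of_nat (n i) + 1 :: complex) k = pochhammer (- of_nat (n i - 1)) k"
    using assms(1) by (simp add: of_nat_diff)
  also have "\<dots> = 0"
    by (rule pochhammer_of_nat_eq_0_lemma) (use assms in auto)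
  finally show ?thesis unfolding A_series_coeff by simp
qed

definition A_coeff where
  "A_coeff p q r a b \<kappa> n m i k =
     A_const p q r a b \<kappa> n m i *
     fps_nth (fps_hypergeo (A_upper p q b \<kappa> n m i) (A_lower p r a \<kappa> i) 1) k"

lemma A_comp_eq_sum:
  "A_comp p q r a b \<kappa> n m \<nu> i z = (\<Sum>k<n i. \<nu> * A_coeff p q r a b \<kappa> n m i k * z ^ k)"
proof (cases "n i = 0")
  case False
  then have "hypergeom (A_upper p q b \<kappa> n m i) (A_lower p r a \<kappa> i) z =
     (\<Sum>k<n i. fps_nth (fps_hypergeo (A_upper p q b \<kappa> n m i) (A_lower p r a \<kappa> i) 1) k * z ^ k)"
    by (intro hypergeom_terminating A_series_terminates) auto
  then show ?thesis using False
    by (simp add: A_comp_def A_coeff_def sum_distrib_left mult.assoc del: fps_hypergeo_nth)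
qed (simp add: A_comp_def)

text \<open>With u = x - n + 1 both (u)_n (u + n)_k and (u)_k (u + k)_n equal (u)_{n+k}, and u + n =
  x + 1; reflecting (u + k)_n produces the sign. For x = \<kappa>_i - \<kappa>_l the three symbols
  attached to l collapse into one factor of \<open>node_deriv\<close>.\<close>

lemma pochhammer_shift_ratio:
  fixes x :: complex
  assumes "x \<notin> \<int>"
  shows "pochhammer (x - of_nat n + 1) k / (pochhammer (x + 1) k * pochhammer (x - of_nat n + 1) n) =
         1 / ((-1) ^ n * pochhammer (- x - of_nat k) n)"
proof -
  let ?u = "x - of_nat n + 1"
  have "?u \<notin> \<int>" using assms
    by (metis Ints_1 Ints_diff Ints_of_nat Ints_add add_diff_cancel_right' diff_add_cancel)
  then have nz: "pochhammer ?u k \<noteq> 0" by (rule pochhammer_nonzero_if_not_Int)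
  have "pochhammer ?u n * pochhammer (x + 1) k = pochhammer ?u (n + k)"
    by (simp add: pochhammer_product')
  also have "\<dots> = pochhammer ?u k * pochhammer (?u + of_nat k) n"
    by (simp add: add.commute [of n k] pochhammer_product')
  also have "pochhammer (?u + of_nat k) n = pochhammer ((x + of_nat k) - of_nat n + 1) n"
    by (simp add: algebra_simps)
  also have "\<dots> = (-1) ^ n * pochhammer (- x - of_nat k) n"
    by (subst pochhammer_minus') simp
  finally show ?thesis using nz
    by (simp add: mult.commute)
qed

lemma pochhammer_neg_nat:
  assumes "k \<le> N"
  shows "pochhammer (- of_nat N :: complex) k = (-1) ^ k * fact N / fact (N - k)"
proof -
  have "(fact N :: complex) = pochhammer 1 (N - k) * pochhammer (1 + of_nat (N - k)) k"
    unfolding pochhammer_fact using pochhammer_product [of "N - k" N "1 :: complex"] assms by simp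
  then have "pochhammer (1 + of_nat (N - k)) k = (fact N / fact (N - k) :: complex)"
    by (simp add: pochhammer_fact [symmetric] field_simps)
  moreover have "pochhammer (- of_nat N :: complex) k = (-1) ^ k * pochhammer (1 + of_nat (N - k)) k"
    unfolding pochhammer_minus using assms by (simp add: of_nat_diff algebra_simps)
  ultimately show ?thesis by simp
qed

text \<open>This explains C_{n,m;i}: its numerator completes the rising factorials of the series to
  Gamma values at s = \<kappa>_i + k, and its denominator completes the remaining ones to
  \<open>node_deriv\<close>.\<close>

lemma A_coeff_eq:
  assumes i: "i \<in> {1..p}" and k: "k < n i"
    and \<kappa>: "\<And>h. h \<in> {1..p} \<Longrightarrow> h \<noteq> i \<Longrightarrow> \<kappa> i - \<kappa> h \<notin> \<int>"
    and bf: "\<And>h. h \<in> {1..q} \<Longrightarrow> gamma_finite (\<kappa> i + b h + 1)"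
    and af: "\<And>h. h \<in> {1..r} \<Longrightarrow> gamma_finite (\<kappa> i + a h + 1)"
  shows "A_coeff p q r a b \<kappa> n m i k =
     - ((\<Prod>h=1..q. Gamma (of_nat k + \<kappa> i + b h + of_nat (m h) + 1)) /
        (\<Prod>h=1..r. Gamma (of_nat k + \<kappa> i + a h + 1))) / node_deriv {1..p} \<kappa> n i k"
proof -
  let ?L = "{1..p} - {i}"
  define N where "N = n i - 1"
  have N: "n i = Suc N" "k \<le> N" using k by (auto simp: N_def)
  have B: "(\<Prod>h=1..q. Gamma (\<kappa> i + b h + 1)) * (\<Prod>h=1..q. pochhammer (\<kappa> i + b h + 1) (m h)) *
      (\<Prod>h=1..q. pochhammer (\<kappa> i + b h + of_nat (m h) + 1) k) =
      (\<Prod>h=1..q. Gamma (of_nat k + \<kappa> i + b h + of_nat (m h) + 1))"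
    unfolding prod.distrib [symmetric]
  proof (rule prod.cong [OF refl])
    fix h assume "h \<in> {1..q}"
    note g = bf [OF this]
    show "Gamma (\<kappa> i + b h + 1) * pochhammer (\<kappa> i + b h + 1) (m h) *
        pochhammer (\<kappa> i + b h + of_nat (m h) + 1) k = Gamma (of_nat k + \<kappa> i + b h + of_nat (m h) + 1)"
      using Gamma_mult_pochhammer [OF g, of "m h"]
        Gamma_mult_pochhammer [OF gamma_finite_add [OF g, of "m h"], of k]
      by (simp add: add_ac)
  qed
  have A: "(\<Prod>h=1..r. Gamma (\<kappa> i + a h + 1)) * (\<Prod>h=1..r. pochhammer (\<kappa> i + a h + 1) k) =
      (\<Prod>h=1..r. Gamma (of_nat k + \<kappa> i + a h + 1))"
    unfolding prod.distrib [symmetric]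
  proof (rule prod.cong [OF refl])
    fix h assume "h \<in> {1..r}"
    note g = af [OF this]
    show "Gamma (\<kappa> i + a h + 1) * pochhammer (\<kappa> i + a h + 1) k = Gamma (of_nat k + \<kappa> i + a h + 1)"
      using Gamma_mult_pochhammer [OF g, of k] by (simp add: add_ac)
  qed
  have L: "(\<Prod>l\<in>?L. pochhammer (\<kappa> i - \<kappa> l - of_nat (n l) + 1) k) /
      ((\<Prod>l\<in>?L. pochhammer (\<kappa> i - \<kappa> l + 1) k) * (\<Prod>l\<in>?L. pochhammer (\<kappa> i - \<kappa> l - of_nat (n l) + 1) (n l))) =
      1 / ((\<Prod>l\<in>?L. (-1) ^ n l) * (\<Prod>l\<in>?L. pochhammer (\<kappa> l - \<kappa> i - of_nat k) (n l)))"
    unfolding prod.distrib [symmetric] prod_dividef [symmetric]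
  proof -
    have "(\<Prod>l\<in>?L. pochhammer (\<kappa> i - \<kappa> l - of_nat (n l) + 1) k /
        (pochhammer (\<kappa> i - \<kappa> l + 1) k * pochhammer (\<kappa> i - \<kappa> l - of_nat (n l) + 1) (n l))) =
        (\<Prod>l\<in>?L. 1 / ((-1) ^ n l * pochhammer (- (\<kappa> i - \<kappa> l) - of_nat k) (n l)))"
      by (rule prod.cong [OF refl], rule pochhammer_shift_ratio) (use \<kappa> in auto)
    then show "(\<Prod>l\<in>?L. pochhammer (\<kappa> i - \<kappa> l - of_nat (n l) + 1) k /
        (pochhammer (\<kappa> i - \<kappa> l + 1) k * pochhammer (\<kappa> i - \<kappa> l - of_nat (n l) + 1) (n l))) =
        1 / (\<Prod>l\<in>?L. (-1) ^ n l * pochhammer (\<kappa> l - \<kappa> i - of_nat k) (n l))"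
      by (simp add: prod_dividef)
  qed
  have F: "pochhammer (- of_nat (n i) + 1 :: complex) k / ((-1) ^ N * fact N * fact k) =
      1 / ((-1) ^ N * ((-1) ^ k * fact k * fact (N - k)))"
  proof -
    have "pochhammer (- of_nat (n i) + 1 :: complex) k = (-1) ^ k * fact N / fact (N - k)"
      using pochhammer_neg_nat [OF N(2)] by (simp add: N(1))
    then show ?thesis by (cases "even k") simp_all
  qed
  \<comment> \<open>The sign (-1)^|n| meets (-1)^(n_i - 1) from the constant and (-1)^(n_l) from
    each reflected symbol; the one power left over gives -1.\<close>
  have sign: "(-1 :: complex) ^ vec_size p n / ((-1) ^ N * (\<Prod>l\<in>?L. (-1) ^ n l)) = -1"
  proof -
    have "vec_size p n = n i + (\<Sum>l\<in>?L. n l)"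
      using i by (simp add: vec_size_def sum.remove)
    then have "(-1 :: complex) ^ vec_size p n = - ((-1) ^ N * (\<Prod>l\<in>?L. (-1) ^ n l))"
      by (simp add: N(1) power_add power_sum)
    then show ?thesis by simp
  qed
  have E: "node_deriv {1..p} \<kappa> n i k = (-1) ^ k * fact k * fact (N - k) *
      (\<Prod>l\<in>?L. pochhammer (\<kappa> l - \<kappa> i - of_nat k) (n l))"
    by (simp add: node_deriv_def N(1))
  \<comment> \<open>Regroups the factors into the blocks evaluated in \<open>B\<close>,
    \<open>A\<close>, \<open>F\<close> and \<open>L\<close>.\<close>
  have alg: "s * (gb / ga) * (pb / (sN * fN * pn)) * (x * pbm * pk / (pa * pk1 * fk)) =
     s * (gb * pb * pbm) / (ga * pa) * (x / (sN * fN * fk)) * (pk / (pk1 * pn))"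
    for s gb ga pb sN fN pn x pbm pk pa pk1 fk :: complex
    by (simp add: divide_inverse mult_ac)
  have "A_coeff p q r a b \<kappa> n m i k =
     (-1) ^ vec_size p n * (\<Prod>h=1..q. Gamma (of_nat k + \<kappa> i + b h + of_nat (m h) + 1)) /
        (\<Prod>h=1..r. Gamma (of_nat k + \<kappa> i + a h + 1)) *
     (1 / ((-1) ^ N * ((-1) ^ k * fact k * fact (N - k)))) *
     (1 / ((\<Prod>l\<in>?L. (-1) ^ n l) * (\<Prod>l\<in>?L. pochhammer (\<kappa> l - \<kappa> i - of_nat k) (n l))))"
    unfolding A_coeff_def A_const_def A_series_coeff N_def [symmetric] alg A B F L ..
  also have "\<dots> = ((-1) ^ vec_size p n / ((-1) ^ N * (\<Prod>l\<in>?L. (-1) ^ n l))) *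
     ((\<Prod>h=1..q. Gamma (of_nat k + \<kappa> i + b h + of_nat (m h) + 1)) /
        (\<Prod>h=1..r. Gamma (of_nat k + \<kappa> i + a h + 1))) / node_deriv {1..p} \<kappa> n i k"
    unfolding E by (simp add: divide_inverse mult_ac)
  finally show ?thesis unfolding sign by simp
qed

text \<open>A polynomial in y = -s: the a-factors are quotients of Gamma at s + l by Gamma at s, the
  b-factors the corresponding quotients for h in \<open>Q\<close>. It has this meaning only if l +
  [h = j] \<le> m_h on \<open>Q\<close>, since the exponents use truncated subtraction.\<close>

definition A_poly ::
    "nat \<Rightarrow> (nat \<Rightarrow> complex) \<Rightarrow> (nat \<Rightarrow> complex) \<Rightarrow> (nat \<Rightarrow> nat) \<Rightarrow> nat \<Rightarrow> nat \<Rightarrow> nat set \<Rightarrow> complex poly" where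
  "A_poly r a b m j l Q =
     (\<Prod>h=1..r. pochhammer [:a h + 1, -1:] l) *
     (\<Prod>h\<in>Q. pochhammer [:of_nat l + b h + of_bool (h = j) + 1, -1:] (m h - l - of_bool (h = j)))"

lemma degree_A_poly:
  assumes "finite Q"
  shows "degree (A_poly r a b m j l Q) \<le> r * l + (\<Sum>h\<in>Q. m h - l - of_bool (h = j))"
proof -
  have "degree (\<Prod>h=1..r. pochhammer [:a h + 1, -1:] l) \<le> (\<Sum>h=1..r. l)"
    by (rule degree_prod_le_sum) (auto intro: degree_pochhammer_linear_le)
  moreover have "degree (\<Prod>h\<in>Q. pochhammer [:of_nat l + b h + of_bool (h = j) + 1, -1:] (m h - l - of_bool (h = j)))
      \<le> (\<Sum>h\<in>Q. m h - l - of_bool (h = j))"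
    by (rule degree_prod_le_sum) (auto intro: degree_pochhammer_linear_le assms)
  ultimately show ?thesis
    unfolding A_poly_def by (intro order_trans [OF degree_mult_le] add_mono) auto
qed

text \<open>Gamma quotients with index in \<open>Q\<close> have a nonnegative integer shift and
  become Pochhammer symbols; the others are kept. \<open>Q\<close> is everything for the
  orthogonality, and omits the one index with shift -1 for the normalization.\<close>

lemma A_moment_term:
  assumes i: "i \<in> {1..p}" and k: "k < n i"
    and \<kappa>: "\<And>h. h \<in> {1..p} \<Longrightarrow> h \<noteq> i \<Longrightarrow> \<kappa> i - \<kappa> h \<notin> \<int>"
    and bf: "\<And>h. h \<in> {1..q} \<Longrightarrow> gamma_finite (\<kappa> i + b h + 1)"
    and af: "\<And>h. h \<in> {1..r} \<Longrightarrow> gamma_finite (\<kappa> i + a h + 1)"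
    and Q: "Q \<subseteq> {1..q}" "\<And>h. h \<in> Q \<Longrightarrow> l + of_bool (h = j) \<le> m h"
  shows "A_coeff p q r a b \<kappa> n m i k * wcoef q r a b j (of_nat (k + l) + \<kappa> i) =
     - (poly (A_poly r a b m j l Q) (- (\<kappa> i + of_nat k)) / node_deriv {1..p} \<kappa> n i k *
        (\<Prod>h\<in>{1..q}-Q. Gamma (of_nat k + \<kappa> i + b h + of_nat (m h) + 1) /
                          Gamma (of_nat (k + l) + \<kappa> i + b h + of_bool (h = j) + 1)))"
proof -
  define s where "s = of_nat k + \<kappa> i"
  define G where "G h = Gamma (s + b h + of_nat (m h) + 1) / Gamma (of_nat (k + l) + \<kappa> i + b h + of_bool (h = j) + 1)" for h
  have A: "Gamma (of_nat (k + l) + \<kappa> i + a h + 1) / Gamma (s + a h + 1) = pochhammer (a h + 1 + s) l"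
    if "h \<in> {1..r}" for h
  proof -
    have g: "gamma_finite (s + a h + 1)"
      using gamma_finite_add [OF af [OF that], of k] by (simp add: s_def add_ac)
    show ?thesis
      using Gamma_mult_pochhammer [OF g, of l] gamma_finite_nonzero [OF g]
      by (simp add: s_def field_simps)
  qed
  have B: "G h = pochhammer (of_nat l + b h + of_bool (h = j) + 1 + s) (m h - l - of_bool (h = j))"
    if "h \<in> Q" for h
  proof -
    let ?d = "of_bool (h = j) :: nat"
    have g: "gamma_finite (of_nat (k + l) + \<kappa> i + b h + of_bool (h = j) + 1)"
      using gamma_finite_add [OF bf [of h], of "k + l + ?d"] that Q(1)
      by (auto simp: add_ac)
    have "l + ?d \<le> m h" using Q(2) that by blast
    then obtain t where t: "m h = l + ?d + t"
      using le_Suc_ex by blast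
    have eq: "of_nat (k + l) + \<kappa> i + b h + of_bool (h = j) + 1 + of_nat (m h - l - ?d) =
        s + b h + of_nat (m h) + 1"
      unfolding t by (simp add: s_def)
    have "of_nat l + b h + of_bool (h = j) + 1 + s = of_nat (k + l) + \<kappa> i + b h + of_bool (h = j) + 1"
      by (simp add: s_def)
    then show ?thesis
      using Gamma_mult_pochhammer [OF g, of "m h - l - ?d", unfolded eq] gamma_finite_nonzero [OF g]
      unfolding G_def by (metis mult.commute nonzero_divide_eq_eq)
  qed
  have polyQ: "poly (A_poly r a b m j l Q) (- (\<kappa> i + of_nat k)) =
      (\<Prod>h=1..r. Gamma (of_nat (k + l) + \<kappa> i + a h + 1) / Gamma (s + a h + 1)) * (\<Prod>h\<in>Q. G h)"
    unfolding A_poly_def poly_mult poly_prod poly_pochhammer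
    by (intro arg_cong2 [where f = "(*)"] prod.cong refl, subst A)
       (auto simp: B s_def add_ac)
  have nz: "(\<Prod>h=1..q. Gamma (of_nat (k + l) + \<kappa> i + b h + of_bool (h = j) + 1)) \<noteq> 0"
  proof -
    have "Gamma (of_nat (k + l) + \<kappa> i + b h + of_bool (h = j) + 1) \<noteq> 0" if "h \<in> {1..q}" for h
      using gamma_finite_nonzero [OF gamma_finite_add [OF bf [of h], of "k + l + of_bool (h = j)"]] that
      by (auto simp: add_ac)
    then show ?thesis by (subst prod_zero_iff) auto
  qed
  have "(\<Prod>h=1..q. G h) = (\<Prod>h\<in>Q. G h) * (\<Prod>h\<in>{1..q}-Q. G h)"
    using Q(1) by (metis finite_atLeastAtMost mult.commute prod.subset_diff)
  then have G: "(\<Prod>h=1..q. Gamma (s + b h + of_nat (m h) + 1)) =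
      (\<Prod>h\<in>Q. G h) * (\<Prod>h\<in>{1..q}-Q. G h) *
      (\<Prod>h=1..q. Gamma (of_nat (k + l) + \<kappa> i + b h + of_bool (h = j) + 1))"
  proof -
    have "(\<Prod>h=1..q. G h) = (\<Prod>h=1..q. Gamma (s + b h + of_nat (m h) + 1)) /
      (\<Prod>h=1..q. Gamma (of_nat (k + l) + \<kappa> i + b h + of_bool (h = j) + 1))"
      unfolding G_def prod_dividef ..
    then show ?thesis
      using nz \<open>(\<Prod>h=1..q. G h) = (\<Prod>h\<in>Q. G h) * (\<Prod>h\<in>{1..q}-Q. G h)\<close> by (simp add: field_simps)
  qed
  have alg: "- (gq * gr * w / ga) / e * (x / w) = - (x / ga * gq / e * gr)" if "w \<noteq> 0"
    for gq gr w ga e x :: complex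
    using that by (simp add: divide_inverse mult_ac)
  have "A_coeff p q r a b \<kappa> n m i k =
     - ((\<Prod>h=1..q. Gamma (s + b h + of_nat (m h) + 1)) / (\<Prod>h=1..r. Gamma (s + a h + 1))) / node_deriv {1..p} \<kappa> n i k"
    using A_coeff_eq [where i = i and k = k and \<kappa> = \<kappa> and a = a and b = b and r = r and q = q and p = p and n = n and m = m, OF i k \<kappa> bf af]
    by (simp add: s_def)
  moreover have "(\<Prod>h\<in>{1..q}-Q. Gamma (of_nat k + \<kappa> i + b h + of_nat (m h) + 1) /
      Gamma (of_nat (k + l) + \<kappa> i + b h + of_bool (h = j) + 1)) = (\<Prod>h\<in>{1..q}-Q. G h)"
    by (simp only: G_def s_def)
  ultimately show ?thesis
    unfolding polyQ wcoef_def G prod_dividef by (simp only: alg [OF nz])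
qed

lemma A_orthogonality:
  assumes \<kappa>: "\<And>i h. i \<in> {1..p} \<Longrightarrow> h \<in> {1..p} \<Longrightarrow> i \<noteq> h \<Longrightarrow> \<kappa> i - \<kappa> h \<notin> \<int>"
    and bf: "\<And>i h. i \<in> {1..p} \<Longrightarrow> 1 \<le> n i \<Longrightarrow> h \<in> {1..q} \<Longrightarrow> gamma_finite (\<kappa> i + b h + 1)"
    and af: "\<And>i h. i \<in> {1..p} \<Longrightarrow> 1 \<le> n i \<Longrightarrow> h \<in> {1..r} \<Longrightarrow> gamma_finite (\<kappa> i + a h + 1)"
    and size: "vec_size p n = vec_size q m + 1" and "r < q"
    and j: "j \<in> {1..q}" and l: "\<And>h. h \<in> {1..q} \<Longrightarrow> l \<le> m h" "l < m j"
  shows "(\<Sum>i=1..p. \<Sum>k<n i. A_coeff p q r a b \<kappa> n m i k * wcoef q r a b j (of_nat (k + l) + \<kappa> i)) = 0"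
proof -
  let ?P = "A_poly r a b m j l {1..q}"
  have lm: "l + of_bool (h = j) \<le> m h" if "h \<in> {1..q}" for h
    using l that by auto
  \<comment> \<open>Degree count: the unit vector in the weight costs one degree at index j, so the
    degree is at most |m| - 1 = |n| - 2, as the vanishing of the residue sum requires.\<close>
  have "(\<Sum>h=1..q. m h) = (\<Sum>h=1..q. (m h - l - of_bool (h = j)) + l + of_bool (h = j))"
    by (intro sum.cong refl) (use lm in fastforce)
  also have "\<dots> = (\<Sum>h=1..q. m h - l - of_bool (h = j)) + q * l + 1"
    using j by (simp add: sum.distrib of_bool_def)
  finally have "(\<Sum>h=1..q. m h - l - of_bool (h = j)) + q * l + 1 = vec_size q m"
    by (simp add: vec_size_def)
  moreover have "r * l \<le> q * l" using \<open>r < q\<close> by (intro mult_le_mono1) simp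
  moreover have "degree ?P \<le> r * l + (\<Sum>h=1..q. m h - l - of_bool (h = j))"
    by (rule degree_A_poly) simp
  ultimately have "degree ?P + 1 < (\<Sum>i=1..p. n i)"
    using size [unfolded vec_size_def [of p]] by linarith
  then have "(\<Sum>i=1..p. \<Sum>k<n i. poly ?P (- (\<kappa> i + of_nat k)) / node_deriv {1..p} \<kappa> n i k) = 0"
    by (intro pochhammer_sum_residues_zero \<kappa>) auto
  moreover have "(\<Sum>i=1..p. \<Sum>k<n i. A_coeff p q r a b \<kappa> n m i k * wcoef q r a b j (of_nat (k + l) + \<kappa> i)) =
      (\<Sum>i=1..p. \<Sum>k<n i. - (poly ?P (- (\<kappa> i + of_nat k)) / node_deriv {1..p} \<kappa> n i k))"
  proof (intro sum.cong refl)
    fix i k assume ik: "i \<in> {1..p}" "k \<in> {..<n i}"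
    then have "k < n i" "1 \<le> n i" by auto
    then show "A_coeff p q r a b \<kappa> n m i k * wcoef q r a b j (of_nat (k + l) + \<kappa> i) =
      - (poly ?P (- (\<kappa> i + of_nat k)) / node_deriv {1..p} \<kappa> n i k)"
      by (subst A_moment_term [where Q = "{1..q}"]) (use ik \<kappa> bf af lm in auto)
  qed
  ultimately show ?thesis by (simp add: sum_negf)
qed

text \<open>At l = M the quotient of index J is 1/(s + b_J + M + 1). The sum is therefore minus the
  partial fraction expansion of P(y) / prod_i (y + \<kappa>_i)_{n_i} at y = b_J + M + 1, and
  \<open>nu_A\<close> is the reciprocal of the result.\<close>

lemma A_normalization:
  assumes \<kappa>: "\<And>i h. i \<in> {1..p} \<Longrightarrow> h \<in> {1..p} \<Longrightarrow> i \<noteq> h \<Longrightarrow> \<kappa> i - \<kappa> h \<notin> \<int>"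
    and bf: "\<And>i h. i \<in> {1..p} \<Longrightarrow> 1 \<le> n i \<Longrightarrow> h \<in> {1..q} \<Longrightarrow> gamma_finite (\<kappa> i + b h + 1)"
    and af: "\<And>i h. i \<in> {1..p} \<Longrightarrow> 1 \<le> n i \<Longrightarrow> h \<in> {1..r} \<Longrightarrow> gamma_finite (\<kappa> i + a h + 1)"
    and nz: "\<And>i. i \<in> {1..p} \<Longrightarrow> pochhammer (\<kappa> i + b J + of_nat M + 1) (n i) \<noteq> 0"
    and size: "vec_size p n = vec_size q m + 1" and "r < q"
    and J: "J \<in> {1..q}" "m J = M" and M: "\<And>h. h \<in> {1..q} \<Longrightarrow> m h = M \<or> m h = M + 1"
  shows "(\<Sum>i=1..p. \<Sum>k<n i. A_coeff p q r a b \<kappa> n m i k * wcoef q r a b J (of_nat (k + M) + \<kappa> i)) =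
     - ((\<Prod>h=1..r. pochhammer (a h - b J - of_nat M) M) *
        (\<Prod>h\<in>{h\<in>{1..q}. m h = M + 1}. b h - b J)) /
     (\<Prod>i=1..p. pochhammer (\<kappa> i + b J + of_nat M + 1) (n i))"
proof -
  let ?Q = "{1..q} - {J}" and ?y = "b J + of_nat M + 1"
  let ?P = "A_poly r a b m J M ?Q"
  have "(\<Sum>h=1..q. m h) = (\<Sum>h=1..q. (m h - M) + M)"
    by (intro sum.cong refl) (use M in fastforce)
  also have "\<dots> = (\<Sum>h=1..q. m h - M) + q * M"
    by (simp add: sum.distrib)
  finally have "(\<Sum>h=1..q. m h - M) + q * M = vec_size q m"
    by (simp add: vec_size_def)
  moreover have "(\<Sum>h\<in>?Q. m h - M - of_bool (h = J)) \<le> (\<Sum>h=1..q. m h - M)"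
    by (rule order_trans [OF sum_mono sum_mono2]) auto
  moreover have "r * M \<le> q * M" using \<open>r < q\<close> by (intro mult_le_mono1) simp
  moreover have "degree ?P \<le> r * M + (\<Sum>h\<in>?Q. m h - M - of_bool (h = J))"
    by (rule degree_A_poly) simp
  ultimately have deg: "degree ?P < (\<Sum>i=1..p. n i)"
    using size [unfolded vec_size_def [of p]] by linarith
  \<comment> \<open>At this point each a-factor starts at a_h - b_J - M, while a b-factor is b_h -
    b_J for m_h = M + 1 and empty for m_h = M.\<close>
  have Py: "poly ?P ?y = (\<Prod>h=1..r. pochhammer (a h - b J - of_nat M) M) *
      (\<Prod>h\<in>{h\<in>{1..q}. m h = M + 1}. b h - b J)"
  proof -
    have "(\<Prod>h\<in>?Q. pochhammer (of_nat M + b h + of_bool (h = J) + 1 - ?y) (m h - M - of_bool (h = J))) =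
        (\<Prod>h\<in>?Q. if m h = M + 1 then b h - b J else 1)"
    proof (intro prod.cong refl)
      fix h assume h: "h \<in> ?Q"
      then consider "m h = M" | "m h = M + 1" using M by auto
      then show "pochhammer (of_nat M + b h + of_bool (h = J) + 1 - ?y) (m h - M - of_bool (h = J)) =
          (if m h = M + 1 then b h - b J else 1)"
        by cases (use h in auto)
    qed
    also have "\<dots> = (\<Prod>h\<in>{h\<in>{1..q}. m h = M + 1}. b h - b J)"
      using J by (subst prod.inter_filter [symmetric]) (auto intro!: prod.cong)
    moreover have "poly [:u, -1:] y = u - y" for u y :: complex
      by simp
    moreover have "a h + 1 - ?y = a h - b J - of_nat M" for h
      by simp
    ultimately show ?thesis
      unfolding A_poly_def poly_mult poly_prod poly_pochhammer by (simp only:)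
  qed
  have "(\<Sum>i=1..p. \<Sum>k<n i. A_coeff p q r a b \<kappa> n m i k * wcoef q r a b J (of_nat (k + M) + \<kappa> i)) =
      (\<Sum>i=1..p. \<Sum>k<n i. - (poly ?P (- (\<kappa> i + of_nat k)) /
          (node_deriv {1..p} \<kappa> n i k * (?y + (\<kappa> i + of_nat k)))))"
  proof (intro sum.cong refl)
    fix i k assume ik: "i \<in> {1..p}" "k \<in> {..<n i}"
    then have k: "k < n i" "1 \<le> n i" by auto
    have compl: "{1..q} - ?Q = {J}" using J by auto
    have le: "M \<le> m h" if "h \<in> {1..q}" for h
      using M [OF that] by auto
    have t1: "A_coeff p q r a b \<kappa> n m i k * wcoef q r a b J (of_nat (k + M) + \<kappa> i) =
      - (poly ?P (- (\<kappa> i + of_nat k)) / node_deriv {1..p} \<kappa> n i k *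
        (Gamma (of_nat k + \<kappa> i + b J + of_nat M + 1) / Gamma (of_nat (k + M) + \<kappa> i + b J + 1 + 1)))"
      using k by (subst A_moment_term [where Q = ?Q]) (use ik \<kappa> bf af le J compl in auto)
    have t2: "Gamma (of_nat k + \<kappa> i + b J + of_nat M + 1) / Gamma (of_nat (k + M) + \<kappa> i + b J + 1 + 1) =
        1 / (?y + (\<kappa> i + of_nat k))"
    proof -
      have g: "gamma_finite (?y + (\<kappa> i + of_nat k))"
        using gamma_finite_add [OF bf [OF ik(1) k(2) J(1)], of "k + M"] by (simp add: add_ac)
      then have "Gamma (?y + (\<kappa> i + of_nat k) + 1) = (?y + (\<kappa> i + of_nat k)) * Gamma (?y + (\<kappa> i + of_nat k))"
        by (intro Gamma_plus1) (simp add: gamma_finite_def)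
      then show ?thesis using gamma_finite_nonzero [OF g] by (simp add: add_ac)
    qed
    show "A_coeff p q r a b \<kappa> n m i k * wcoef q r a b J (of_nat (k + M) + \<kappa> i) =
      - (poly ?P (- (\<kappa> i + of_nat k)) / (node_deriv {1..p} \<kappa> n i k * (?y + (\<kappa> i + of_nat k))))"
      unfolding t1 t2 by (simp only: times_divide_eq_right mult_1_right divide_divide_eq_left)
  qed
  also have "\<dots> = - (poly ?P ?y / (\<Prod>i=1..p. pochhammer (?y + \<kappa> i) (n i)))"
    unfolding sum_negf
    by (subst pochhammer_partial_fractions [OF _ \<kappa> deg]) (use nz in \<open>auto simp: add_ac\<close>)
  finally show ?thesis unfolding Py by (simp add: add_ac)
qed

section \<open>The mixed polynomials B\<close>

text \<open>The prefactor of the double sum in B^(j), which is also the Lagrange coefficient of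
  prod_h (y + a_h) at the node -b_j.\<close>

definition interp_weight ::
    "nat \<Rightarrow> nat \<Rightarrow> (nat \<Rightarrow> complex) \<Rightarrow> (nat \<Rightarrow> complex) \<Rightarrow> nat \<Rightarrow> complex" where
  "interp_weight q r a b j = (\<Prod>h=1..r. a h - b j) / (\<Prod>h\<in>{1..q}-{j}. b h - b j)"

lemma interp_weight_identity:
  fixes y :: complex
  assumes "r < q" and b: "inj_on b {1..q}"
  shows "(\<Prod>h=1..r. y + a h) =
     (\<Sum>j=1..q. interp_weight q r a b j * (\<Prod>h\<in>{1..q}-{j}. y + b h))"
proof -
  let ?P = "\<Prod>h=1..r. [:a h, 1:] :: complex poly"
  have "degree ?P \<le> (\<Sum>h=1..r. 1)"
    by (rule degree_prod_le_sum) auto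
  then have deg: "degree ?P < card {1..q}" using assms(1) by simp
  have inj: "inj_on (\<lambda>j. - b j) {1..q}"
    using b by (intro inj_onI) (auto dest: inj_onD)
  have "poly ?P y = (\<Sum>j=1..q. poly ?P (- b j) * (\<Prod>h\<in>{1..q}-{j}. (y - - b h) / (- b j - - b h)))"
    by (rule lagrange_interpolation [OF _ inj deg]) simp
  moreover have "poly ?P y = (\<Prod>h=1..r. y + a h)" for y
    by (simp add: poly_prod add.commute)
  ultimately have *: "(\<Prod>h=1..r. y + a h) =
      (\<Sum>j=1..q. (\<Prod>h=1..r. - b j + a h) * (\<Prod>h\<in>{1..q}-{j}. (y - - b h) / (- b j - - b h)))"
    by (simp only:)
  show ?thesis
    unfolding * interp_weight_def by (intro sum.cong refl) (simp add: prod_dividef)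
qed

text \<open>After both products over a are expanded by \<open>interp_weight_identity\<close>, the
  j-th term contains (y + b_j) - (x + b_j) times factors symmetric in x and y.\<close>

lemma interp_weight_christoffel_darboux:
  fixes x y :: complex
  assumes "r < q" and b: "inj_on b {1..q}"
  shows "(\<Prod>h=1..r. x + a h) * (\<Prod>h=1..q. y + b h) - (\<Prod>h=1..r. y + a h) * (\<Prod>h=1..q. x + b h) =
     (y - x) * (\<Sum>j=1..q. interp_weight q r a b j * (\<Prod>h\<in>{1..q}-{j}. x + b h) * (\<Prod>h\<in>{1..q}-{j}. y + b h))"
  unfolding interp_weight_identity [OF assms] sum_distrib_left sum_distrib_right sum_subtractf [symmetric]
proof (rule sum.cong [OF refl])
  fix j assume j: "j \<in> {1..q}"
  have p: "(\<Prod>h=1..q. z + b h) = (z + b j) * (\<Prod>h\<in>{1..q}-{j}. z + b h)" for z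
    using j by (simp add: prod.remove)
  show "interp_weight q r a b j * (\<Prod>h\<in>{1..q}-{j}. x + b h) * (\<Prod>h=1..q. y + b h) -
        interp_weight q r a b j * (\<Prod>h\<in>{1..q}-{j}. y + b h) * (\<Prod>h=1..q. x + b h) =
        (y - x) * (interp_weight q r a b j * (\<Prod>h\<in>{1..q}-{j}. x + b h) * (\<Prod>h\<in>{1..q}-{j}. y + b h))"
    unfolding p by (simp add: algebra_simps)
qed

text \<open>Coefficient of z^k in the summand of B^(j) with x = b_H + K, apart from \<pi>_{H,K} and
  \<open>interp_weight\<close>. The length-one symbols in front of the hypergeometric series extend
  the symbols from k to k + 1, except the one of index j.\<close>

definition tele_coeff ::
    "nat \<Rightarrow> nat \<Rightarrow> (nat \<Rightarrow> complex) \<Rightarrow> (nat \<Rightarrow> complex) \<Rightarrow> nat \<Rightarrow> complex \<Rightarrow> nat \<Rightarrow> complex" where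
  "tele_coeff q r a b j x k =
     (\<Prod>h\<in>{1..q}-{j}. pochhammer (b h - x) (k + 1)) * pochhammer (b j - x) k /
     (\<Prod>h=1..r. pochhammer (a h - x) (k + 1))"

text \<open>Growth of the Gamma quotient from s to s + k with the unit vector e_j left out, hence
  the same for all j.\<close>

definition shift_ratio ::
    "nat \<Rightarrow> nat \<Rightarrow> (nat \<Rightarrow> complex) \<Rightarrow> (nat \<Rightarrow> complex) \<Rightarrow> complex \<Rightarrow> nat \<Rightarrow> complex" where
  "shift_ratio q r a b s k =
     (\<Prod>h=1..r. pochhammer (s + a h + 1) k) / (\<Prod>h=1..q. pochhammer (s + b h + 1) k)"

lemma prod_pochhammer_Suc:
  "(\<Prod>h\<in>A. pochhammer (f h) (k + 1)) = (\<Prod>h\<in>A. pochhammer (f h) k) * (\<Prod>h\<in>A. f h + of_nat k)"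
  by (simp add: pochhammer_Suc prod.distrib)

text \<open>Write \<alpha> and \<beta> for the products over a and b, X = k - x, Y = s + 1 + k.
  Passing from u_k to u_{k+1} multiplies by \<alpha>(Y) \<beta>(X) / (\<beta>(Y) \<alpha>(X)), so
  the difference has the numerator of the Christoffel-Darboux identity and contains the factor Y - X
  = s + 1 + x, free of k.\<close>

lemma telescoping_step:
  fixes s x :: complex
  assumes "r < q" and b: "inj_on b {1..q}"
    and sb: "\<And>h. h \<in> {1..q} \<Longrightarrow> s + b h + 1 + of_nat k \<noteq> 0"
    and ax: "\<And>h. h \<in> {1..r} \<Longrightarrow> a h - x + of_nat k \<noteq> 0"
  defines "u \<equiv> \<lambda>k. shift_ratio q r a b s k * (\<Prod>h=1..q. pochhammer (b h - x) k) /
                     (\<Prod>h=1..r. pochhammer (a h - x) k)"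
  shows "u k - u (k + 1) = (s + 1 + x) *
     (\<Sum>j=1..q. interp_weight q r a b j * tele_coeff q r a b j x k *
        (shift_ratio q r a b s k / (s + of_nat k + b j + 1)))"
proof -
  define S where "S = shift_ratio q r a b s k"
  define Bx where "Bx = (\<Prod>h=1..q. pochhammer (b h - x) k)"
  define Ax where "Ax = (\<Prod>h=1..r. pochhammer (a h - x) k)"
  define \<alpha> where "\<alpha> z = (\<Prod>h=1..r. z + a h)" for z
  define \<beta> where "\<beta> z = (\<Prod>h=1..q. z + b h)" for z
  define \<gamma> where "\<gamma> j z = (\<Prod>h\<in>{1..q}-{j}. z + b h)" for j z
  define w where "w j = interp_weight q r a b j" for j
  let ?x = "of_nat k - x" and ?y = "s + 1 + of_nat k"
  have sh: "(\<Prod>h\<in>A. f h - x + of_nat k) = (\<Prod>h\<in>A. ?x + f h)"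
    "(\<Prod>h\<in>A. s + f h + 1 + of_nat k) = (\<Prod>h\<in>A. ?y + f h)" for A and f :: "nat \<Rightarrow> complex"
    by (simp_all add: algebra_simps)
  have \<beta>y: "\<beta> ?y \<noteq> 0"
    unfolding \<beta>_def sh(2) [symmetric] using sb by (subst prod_zero_iff) auto
  have \<alpha>x: "\<alpha> ?x \<noteq> 0"
    unfolding \<alpha>_def sh(1) [symmetric] using ax by (subst prod_zero_iff) auto
  have u0: "u k = S * Bx / Ax" by (simp add: u_def S_def Bx_def Ax_def)
  have u1: "u (k + 1) = S * \<alpha> ?y / \<beta> ?y * (Bx * \<beta> ?x) / (Ax * \<alpha> ?x)"
    unfolding u_def shift_ratio_def prod_pochhammer_Suc sh
    by (simp add: S_def shift_ratio_def Bx_def Ax_def \<alpha>_def \<beta>_def)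
  have t: "tele_coeff q r a b j x k = Bx * \<gamma> j ?x / (Ax * \<alpha> ?x)" if j: "j \<in> {1..q}" for j
  proof -
    have "Bx = pochhammer (b j - x) k * (\<Prod>h\<in>{1..q}-{j}. pochhammer (b h - x) k)"
      unfolding Bx_def using j by (simp add: prod.remove)
    then show ?thesis
      unfolding tele_coeff_def prod_pochhammer_Suc sh by (simp add: Ax_def \<alpha>_def \<gamma>_def)
  qed
  have g: "\<gamma> j ?y / \<beta> ?y = 1 / (s + of_nat k + b j + 1)" if j: "j \<in> {1..q}" for j
  proof -
    have "\<beta> ?y = (s + of_nat k + b j + 1) * \<gamma> j ?y"
      unfolding \<beta>_def \<gamma>_def using j by (simp add: prod.remove add_ac)
    then show ?thesis using \<beta>y by simp
  qed
  have "u k - u (k + 1) = S * Bx / (Ax * \<alpha> ?x * \<beta> ?y) * (\<alpha> ?x * \<beta> ?y - \<alpha> ?y * \<beta> ?x)"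
  \<comment> \<open>Only the k-th factors over a are assumed nonzero. If an earlier one vanishes,
    both sides are 0 because division by 0 gives 0.\<close>
  proof (cases "Ax = 0")
    case False
    then show ?thesis unfolding u0 u1 using \<alpha>x \<beta>y by (simp add: field_simps)
  next
    case True
    then show ?thesis unfolding u0 u1 by simp
  qed
  also have "\<alpha> ?x * \<beta> ?y - \<alpha> ?y * \<beta> ?x = (s + 1 + x) * (\<Sum>j=1..q. w j * \<gamma> j ?x * \<gamma> j ?y)"
    unfolding \<alpha>_def \<beta>_def \<gamma>_def w_def interp_weight_christoffel_darboux [OF assms(1,2)] by simp
  also have "S * Bx / (Ax * \<alpha> ?x * \<beta> ?y) * ((s + 1 + x) * (\<Sum>j=1..q. w j * \<gamma> j ?x * \<gamma> j ?y)) =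
      (s + 1 + x) * (\<Sum>j=1..q. w j * (Bx * \<gamma> j ?x / (Ax * \<alpha> ?x)) * (S * (\<gamma> j ?y / \<beta> ?y)))"
    by (simp add: sum_distrib_left divide_inverse mult_ac)
  also have "\<dots> = (s + 1 + x) * (\<Sum>j=1..q. w j * tele_coeff q r a b j x k * (S / (s + of_nat k + b j + 1)))"
    by (intro arg_cong2 [where f = "(*)"] sum.cong refl) (simp_all only: t g times_divide_eq_right mult_1_right)
  finally show ?thesis unfolding w_def S_def .
qed

text \<open>The chain starts at u_0 = 1 and ends at u_d = 0, since (b_H - x)_d = (-K)_d vanishes for
  K < d. The cut-off d stays free so that all pairs (H,K) and all components can share one
  range.\<close>

lemma telescoping_sum:
  fixes s x :: complex
  assumes "r < q" and b: "inj_on b {1..q}"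
    and sb: "\<And>h. h \<in> {1..q} \<Longrightarrow> gamma_finite (s + b h + 1)"
    and ax: "\<And>h. h \<in> {1..r} \<Longrightarrow> gamma_finite (a h - x)"
    and H: "H \<in> {1..q}" "x = b H + of_nat K" "K < d"
  shows "(\<Sum>j=1..q. \<Sum>k<d. interp_weight q r a b j * tele_coeff q r a b j x k *
            (shift_ratio q r a b s k / (s + of_nat k + b j + 1))) = 1 / (s + 1 + x)"
proof -
  define u where "u k = shift_ratio q r a b s k * (\<Prod>h=1..q. pochhammer (b h - x) k) /
                     (\<Prod>h=1..r. pochhammer (a h - x) k)" for k
  have nz: "y + of_nat k \<noteq> 0" if "gamma_finite y" for y and k :: nat
    using gamma_finite_add [OF that, of k] by (auto simp: gamma_finite_def)
  have "s + b H + 1 + of_nat K \<noteq> 0" using nz sb H(1) by blast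
  then have sx: "s + 1 + x \<noteq> 0" by (simp add: H(2) add_ac)
  have "pochhammer (b H - x) d = 0"
    unfolding H(2) using H(3) by (simp add: pochhammer_of_nat_eq_0_lemma)
  then have "(\<Prod>h=1..q. pochhammer (b h - x) d) = 0"
    using H(1) by (intro prod_zero) auto
  then have "1 = u 0 - u d" by (simp add: u_def shift_ratio_def)
  also have "\<dots> = (\<Sum>k<d. u k - u (k + 1))"
    by (simp add: sum_lessThan_telescope')
  also have "\<dots> = (\<Sum>k<d. (s + 1 + x) * (\<Sum>j=1..q. interp_weight q r a b j * tele_coeff q r a b j x k *
            (shift_ratio q r a b s k / (s + of_nat k + b j + 1))))"
    unfolding u_def
    by (intro sum.cong refl telescoping_step assms(1) b nz sb ax)
  also have "\<dots> = (s + 1 + x) * (\<Sum>j=1..q. \<Sum>k<d. interp_weight q r a b j * tele_coeff q r a b j x k *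
            (shift_ratio q r a b s k / (s + of_nat k + b j + 1)))"
    by (subst sum.swap) (simp only: sum_distrib_left)
  finally show ?thesis using sx by (simp add: nonzero_eq_divide_eq mult.commute)
qed

text \<open>The unit vector replaces one Gamma value in the denominator by the next, which costs the
  factor s + k + b_j + 1. The Gamma quotient in front depends on neither j nor k and can be pulled
  out of the orthogonality sums.\<close>

lemma wcoef_shift:
  assumes sb: "\<And>h. h \<in> {1..q} \<Longrightarrow> gamma_finite (s + b h + 1)"
    and sa: "\<And>h. h \<in> {1..r} \<Longrightarrow> gamma_finite (s + a h + 1)"
    and j: "j \<in> {1..q}"
  shows "wcoef q r a b j (s + of_nat k) =
     (\<Prod>h=1..r. Gamma (s + a h + 1)) / (\<Prod>h=1..q. Gamma (s + b h + 1)) *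
     (shift_ratio q r a b s k / (s + of_nat k + b j + 1))"
proof -
  have A: "(\<Prod>h=1..r. Gamma (s + of_nat k + a h + 1)) =
      (\<Prod>h=1..r. Gamma (s + a h + 1)) * (\<Prod>h=1..r. pochhammer (s + a h + 1) k)"
    unfolding prod.distrib [symmetric]
  proof (rule prod.cong [OF refl])
    fix h assume "h \<in> {1..r}"
    note Gamma_mult_pochhammer [OF sa [OF this], of k]
    moreover have "s + a h + 1 + of_nat k = s + of_nat k + a h + 1" by simp
    ultimately show "Gamma (s + of_nat k + a h + 1) = Gamma (s + a h + 1) * pochhammer (s + a h + 1) k"
      by (simp only:)
  qed
  have B: "(\<Prod>h=1..q. Gamma (s + of_nat k + b h + 1)) =
      (\<Prod>h=1..q. Gamma (s + b h + 1)) * (\<Prod>h=1..q. pochhammer (s + b h + 1) k)"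
    unfolding prod.distrib [symmetric]
  proof (rule prod.cong [OF refl])
    fix h assume "h \<in> {1..q}"
    note Gamma_mult_pochhammer [OF sb [OF this], of k]
    moreover have "s + b h + 1 + of_nat k = s + of_nat k + b h + 1" by simp
    ultimately show "Gamma (s + of_nat k + b h + 1) = Gamma (s + b h + 1) * pochhammer (s + b h + 1) k"
      by (simp only:)
  qed
  have "gamma_finite (s + of_nat k + b j + 1)"
    using gamma_finite_add [OF sb [OF j], of k] by (simp add: add_ac)
  then have G: "Gamma (s + of_nat k + b j + 1 + 1) = (s + of_nat k + b j + 1) * Gamma (s + of_nat k + b j + 1)"
    by (intro Gamma_plus1) (simp add: gamma_finite_def)
  have "(\<Prod>h=1..q. Gamma (s + of_nat k + b h + of_bool (h = j) + 1)) =
      Gamma (s + of_nat k + b j + 1 + 1) * (\<Prod>h\<in>{1..q}-{j}. Gamma (s + of_nat k + b h + 1))"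
    using j by (subst prod.remove [of _ j]) (auto intro!: prod.cong)
  also have "\<dots> = (s + of_nat k + b j + 1) * (\<Prod>h=1..q. Gamma (s + of_nat k + b h + 1))"
    unfolding G using j by (subst (2) prod.remove [of _ j]) simp_all
  finally show ?thesis
    unfolding wcoef_def A B shift_ratio_def by (simp add: divide_inverse mult_ac)
qed

text \<open>The isolated \<pi>_{j,0} is the K = 0 summand in disguise: at x = b_H
  \<open>tele_coeff\<close> vanishes unless H = j and k = 0, and there, for admissible parameters,
  it is the reciprocal of \<open>interp_weight\<close>.\<close>

definition B_coeff where
  "B_coeff p q r a b \<kappa> n m j k =
     (if k = 0 then pi_coeff p q b \<kappa> n m j 0 else 0) +
     interp_weight q r a b j *
     (\<Sum>H=1..q. \<Sum>K=1..m H - 1. pi_coeff p q b \<kappa> n m H K * tele_coeff q r a b j (b H + of_nat K) k)"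

section \<open>Termination of the series in B\<close>

lemma near_diagonal_le_Suc:
  assumes "near_diagonal q m" "j \<in> {1..q}" "h \<in> {1..q}"
  shows "m h \<le> m j + 1"
  using assms unfolding near_diagonal_def by fastforce

lemma pochhammer_neg_diff_eq_0:
  "K < k \<Longrightarrow> pochhammer (y - (y + of_nat K) :: complex) k = 0"
  by (simp add: pochhammer_of_nat_eq_0_lemma)

text \<open>The symbol of index H has base -K. Its length is k if H = j and k + 1 otherwise, whence
  the two thresholds.\<close>

lemma tele_coeff_eq_0:
  assumes H: "H \<in> {1..q}" and "if H = j then K < k else K \<le> k"
  shows "tele_coeff q r a b j (b H + of_nat K) k = 0"
proof (cases "H = j")
  case True
  then show ?thesis using assms pochhammer_neg_diff_eq_0 [of K k "b H"]
    by (simp add: tele_coeff_def)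
next
  case False
  then have "(\<Prod>h\<in>{1..q}-{j}. pochhammer (b h - (b H + of_nat K)) (k + 1)) = 0"
    using assms pochhammer_neg_diff_eq_0 [of K "k + 1" "b H"]
    by (intro prod_zero bexI [of _ H]) auto
  then show ?thesis by (simp only: tele_coeff_def) simp
qed

text \<open>The upper parameter 1 contributes (1)_k = k!, which cancels the factorial of the
  series.\<close>

lemma B_series_coeff:
  "fps_nth (fps_hypergeo
     ([1] @ map (\<lambda>h. b h - x + 1 - of_bool (h = j)) [1..<q+1])
     (map (\<lambda>h. a h - x + 1) [1..<r+1]) 1) k =
   (\<Prod>h=1..q. pochhammer (b h - x + 1 - of_bool (h = j)) k) / (\<Prod>h=1..r. pochhammer (a h - x + 1) k :: complex)"
  unfolding fps_nth_hypergeo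
  by (simp only: map_append prod_list.append map_map o_def prod_list_map_upt)
     (simp add: pochhammer_fact [symmetric])

lemma B_series_tele:
  assumes j: "j \<in> {1..q}"
  shows "(\<Prod>h\<in>{1..q}-{j}. pochhammer (b h - x) 1) / (\<Prod>h=1..r. pochhammer (a h - x) 1) *
     fps_nth (fps_hypergeo
       ([1] @ map (\<lambda>h. b h - x + 1 - of_bool (h = j)) [1..<q+1])
       (map (\<lambda>h. a h - x + 1) [1..<r+1]) 1) k = tele_coeff q r a b j x k"
proof -
  have "(\<Prod>h=1..q. pochhammer (b h - x + 1 - of_bool (h = j)) k) =
     pochhammer (b j - x) k * (\<Prod>h\<in>{1..q}-{j}. pochhammer (b h - x + 1) k)"
    using j by (subst prod.remove [of _ j]) (auto intro!: prod.cong)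
  then show ?thesis
    unfolding B_series_coeff
    by (simp add: tele_coeff_def pochhammer_rec prod.distrib)
qed

lemma B_comp_eq_sum:
  assumes nd: "near_diagonal q m" and j: "j \<in> {1..q}" and d: "m j \<le> d"
  shows "B_comp p q r a b \<kappa> n m \<nu> j z = (\<Sum>k<d. \<nu> * B_coeff p q r a b \<kappa> n m j k * z ^ k)"
proof (cases "m j = 0")
  case True
  \<comment> \<open>Near the diagonal m_j = 0 forces m_H \<le> 1, so the double sum is
    empty.\<close>
  have "m H - 1 = 0" if "H \<in> {1..q}" for H
    using near_diagonal_le_Suc [OF nd j that] True by simp
  then have "B_coeff p q r a b \<kappa> n m j k = 0" for k
    by (simp add: B_coeff_def pi_coeff_def True)
  then show ?thesis by (simp add: B_comp_def True)
next
  case False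
  let ?F = "\<lambda>x. fps_hypergeo
       ([1] @ map (\<lambda>h. b h - x + 1 - of_bool (h = j)) [1..<q+1])
       (map (\<lambda>h. a h - x + 1) [1..<r+1]) 1"
  let ?c = "\<lambda>x. (\<Prod>h\<in>{1..q}-{j}. pochhammer (b h - x) 1) / (\<Prod>h=1..r. pochhammer (a h - x) 1)"
  let ?w = "interp_weight q r a b j"
  have hyp: "?c (b H + of_nat K) * hypergeom
         ([1] @ map (\<lambda>h. b h - (b H + of_nat K) + 1 - of_bool (h = j)) [1..<q+1])
         (map (\<lambda>h. a h - (b H + of_nat K) + 1) [1..<r+1]) z =
       (\<Sum>k<d. tele_coeff q r a b j (b H + of_nat K) k * z ^ k)"
    if H: "H \<in> {1..q}" "K \<in> {1..m H - 1}" for H K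
  proof -
    let ?x = "b H + of_nat K"
    have "fps_nth (?F ?x) k = 0" if "k \<ge> d" for k
    proof -
      \<comment> \<open>The parameter of index H is -K for H = j and 1 - K otherwise. In the second
        case K \<le> m_H - 1 \<le> m_j, so the last surviving power is still below m_j.\<close>
      have "pochhammer (b H - ?x + 1 - of_bool (H = j)) k = 0"
      proof (cases "H = j")
        case True
        then have "K < k" using H d that by auto
        then show ?thesis using True by (simp add: pochhammer_of_nat_eq_0_lemma)
      next
        case False
        have "K - 1 < k" using H d that near_diagonal_le_Suc [OF nd j H(1)] by auto
        then have "pochhammer (- of_nat (K - 1) :: complex) k = 0"
          by (rule pochhammer_of_nat_eq_0_lemma)
        then show ?thesis using False H by (simp add: of_nat_diff)
      qed
      then have "(\<Prod>h=1..q. pochhammer (b h - ?x + 1 - of_bool (h = j)) k) = 0"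
        using H(1) by (intro prod_zero bexI [of _ H]) auto
      then show ?thesis unfolding B_series_coeff by (simp only: div_0)
    qed
    then show ?thesis
      by (subst hypergeom_terminating [of d])
         (simp_all only: sum_distrib_left B_series_tele [OF j] mult.assoc [symmetric])
  qed
  have w: "(\<Prod>h=1..r. pochhammer (a h - b j) 1) / (\<Prod>h\<in>{1..q}-{j}. pochhammer (b h - b j) 1) = ?w"
    by (simp add: interp_weight_def)
  define T where "T k = (\<Sum>H=1..q. \<Sum>K=1..m H - 1. pi_coeff p q b \<kappa> n m H K *
        tele_coeff q r a b j (b H + of_nat K) k)" for k
  have B: "B_coeff p q r a b \<kappa> n m j k =
      (if k = 0 then pi_coeff p q b \<kappa> n m j 0 else 0) + ?w * T k" for k
    by (simp add: B_coeff_def T_def)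
  have "B_comp p q r a b \<kappa> n m \<nu> j z = \<nu> * (pi_coeff p q b \<kappa> n m j 0 + ?w *
      (\<Sum>H=1..q. \<Sum>K=1..m H - 1. pi_coeff p q b \<kappa> n m H K *
        (\<Sum>k<d. tele_coeff q r a b j (b H + of_nat K) k * z ^ k)))"
    unfolding B_comp_def w using False
    by (simp only: if_False mult.assoc hyp cong: sum.cong)
  also have "(\<Sum>H=1..q. \<Sum>K=1..m H - 1. pi_coeff p q b \<kappa> n m H K *
        (\<Sum>k<d. tele_coeff q r a b j (b H + of_nat K) k * z ^ k)) =
      (\<Sum>H=1..q. \<Sum>K=1..m H - 1. \<Sum>k<d. pi_coeff p q b \<kappa> n m H K *
        tele_coeff q r a b j (b H + of_nat K) k * z ^ k)"
    by (simp add: sum_distrib_left mult.assoc)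
  also have "\<dots> = (\<Sum>k<d. \<Sum>H=1..q. \<Sum>K=1..m H - 1. pi_coeff p q b \<kappa> n m H K *
        tele_coeff q r a b j (b H + of_nat K) k * z ^ k)"
    by (subst (2) sum.swap, subst sum.swap) (rule refl)
  also have "\<dots> = (\<Sum>k<d. T k * z ^ k)"
    by (simp only: T_def sum_distrib_right)
  \<comment> \<open>The constant term sits at k = 0, which is in range because 0 < m_j \<le>
    d.\<close>
  also have "pi_coeff p q b \<kappa> n m j 0 = (\<Sum>k<d. if k = 0 then pi_coeff p q b \<kappa> n m j 0 else 0)"
    using False d by simp
  also have "\<dots> = (\<Sum>k<d. (if k = 0 then pi_coeff p q b \<kappa> n m j 0 else 0) * z ^ k)"
    by (rule sum.cong) auto
  finally show ?thesis
    by (simp only: B T_def [symmetric] sum_distrib_left distrib_left distrib_right sum.distrib mult.assoc)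
qed

lemma B_coeff_eq_0:
  assumes nd: "near_diagonal q m" and j: "j \<in> {1..q}" and k: "m j \<le> k"
  shows "B_coeff p q r a b \<kappa> n m j k = 0"
proof -
  have "tele_coeff q r a b j (b H + of_nat K) k = 0" if "H \<in> {1..q}" "K \<in> {1..m H - 1}" for H K
    by (rule tele_coeff_eq_0) (use that k near_diagonal_le_Suc [OF nd j that(1)] in auto)
  then have "(\<Sum>H=1..q. \<Sum>K=1..m H - 1. pi_coeff p q b \<kappa> n m H K * tele_coeff q r a b j (b H + of_nat K) k) = 0"
    by (intro sum.neutral ballI) (simp only: mult_zero_right)
  then show ?thesis using k by (simp add: B_coeff_def pi_coeff_def)
qed

section \<open>Residues and orthogonality for B\<close>

lemma pi_coeff_eq:
  assumes "K < m H"
  shows "pi_coeff p q b \<kappa> n m H K =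
     - (\<Prod>i=1..p. pochhammer (\<kappa> i + b H + of_nat K + 1) (n i)) / node_deriv {1..q} b m H K"
  using assms by (simp add: pi_coeff_def node_deriv_def mult.assoc)

text \<open>Partial fractions at y = s + 1 with poles -(b_H + K): the numerator prod_i (\<kappa>_i +
  1 - y)_{n_i} has degree at most |n| < |m|, and its values at the poles are the numerators of
  \<pi>_{H,K} up to sign.\<close>

lemma pi_coeff_partial_fractions:
  assumes b: "\<And>i h. i \<in> {1..q} \<Longrightarrow> h \<in> {1..q} \<Longrightarrow> i \<noteq> h \<Longrightarrow> b i - b h \<notin> \<int>"
    and size: "vec_size q m = vec_size p n + 1"
    and s: "\<And>h. h \<in> {1..q} \<Longrightarrow> gamma_finite (s + b h + 1)"
  shows "(\<Sum>H=1..q. \<Sum>K<m H. pi_coeff p q b \<kappa> n m H K / (s + 1 + (b H + of_nat K))) =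
     - (\<Prod>i=1..p. pochhammer (\<kappa> i - s) (n i)) / (\<Prod>h=1..q. pochhammer (s + 1 + b h) (m h))"
proof -
  let ?P = "\<Prod>i=1..p. pochhammer [:\<kappa> i + 1, -1:] (n i)"
  have P: "poly ?P y = (\<Prod>i=1..p. pochhammer (\<kappa> i + 1 - y) (n i))" for y
  proof -
    have "poly [:u, -1:] y = u - y" for u :: complex by simp
    then show ?thesis by (simp only: poly_prod poly_pochhammer)
  qed
  have "degree ?P \<le> (\<Sum>i=1..p. n i)"
    by (rule degree_prod_le_sum) (auto intro: degree_pochhammer_linear_le)
  then have deg: "degree ?P < (\<Sum>h=1..q. m h)" using size by (simp add: vec_size_def)
  have nz: "pochhammer (s + 1 + b h) (m h) \<noteq> 0" if "h \<in> {1..q}" for h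
    using gamma_finite_pochhammer_nonzero [OF s [OF that]] by (simp add: add_ac)
  have "(\<Sum>H=1..q. \<Sum>K<m H. pi_coeff p q b \<kappa> n m H K / (s + 1 + (b H + of_nat K))) =
     (\<Sum>H=1..q. \<Sum>K<m H. - (poly ?P (- (b H + of_nat K)) /
        (node_deriv {1..q} b m H K * (s + 1 + (b H + of_nat K)))))"
  proof (intro sum.cong refl)
    fix H K assume "K \<in> {..<m H}"
    then have K: "K < m H" by simp
    have "poly ?P (- (b H + of_nat K)) = (\<Prod>i=1..p. pochhammer (\<kappa> i + b H + of_nat K + 1) (n i))"
      unfolding P by (simp add: algebra_simps)
    then show "pi_coeff p q b \<kappa> n m H K / (s + 1 + (b H + of_nat K)) =
       - (poly ?P (- (b H + of_nat K)) / (node_deriv {1..q} b m H K * (s + 1 + (b H + of_nat K))))"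
      unfolding pi_coeff_eq [of K m H, OF K] by simp
  qed
  also have "\<dots> = - (poly ?P (s + 1) / (\<Prod>h=1..q. pochhammer (s + 1 + b h) (m h)))"
    unfolding sum_negf
    by (subst pochhammer_partial_fractions [OF _ b deg]) (use nz in auto)
  finally show ?thesis unfolding P by simp
qed

lemma sum_swap_dependent:
  "(\<Sum>j\<in>A. \<Sum>k\<in>B. \<Sum>h\<in>C. \<Sum>l\<in>D h. f j k h l) =
   (\<Sum>h\<in>C. \<Sum>l\<in>D h. \<Sum>j\<in>A. \<Sum>k\<in>B. f j k h l)"
proof -
  have "(\<Sum>j\<in>A. \<Sum>k\<in>B. \<Sum>h\<in>C. \<Sum>l\<in>D h. f j k h l) =
      (\<Sum>x\<in>A \<times> B. \<Sum>h\<in>C. \<Sum>l\<in>D h. f (fst x) (snd x) h l)"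
    by (subst sum.cartesian_product) (simp add: case_prod_unfold)
  also have "\<dots> = (\<Sum>h\<in>C. \<Sum>x\<in>A \<times> B. \<Sum>l\<in>D h. f (fst x) (snd x) h l)"
    by (rule sum.swap)
  also have "\<dots> = (\<Sum>h\<in>C. \<Sum>l\<in>D h. \<Sum>x\<in>A \<times> B. f (fst x) (snd x) h l)"
    by (intro sum.cong refl sum.swap)
  also have "\<dots> = (\<Sum>h\<in>C. \<Sum>l\<in>D h. \<Sum>j\<in>A. \<Sum>k\<in>B. f j k h l)"
    by (intro sum.cong refl, subst sum.cartesian_product) (simp add: case_prod_unfold)
  finally show ?thesis .
qed

text \<open>Telescoping turns the double sum into the poles with K \<ge> 1, and the isolated
  constants supply those with K = 0; together they are the complete partial fraction
  expansion.\<close>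

lemma B_orthogonality:
  assumes b: "\<And>i h. i \<in> {1..q} \<Longrightarrow> h \<in> {1..q} \<Longrightarrow> i \<noteq> h \<Longrightarrow> b i - b h \<notin> \<int>"
    and size: "vec_size q m = vec_size p n + 1" and "r < q"
    and s: "s = of_nat l + \<kappa> i" "i \<in> {1..p}" "l < n i"
    and sb: "\<And>h. h \<in> {1..q} \<Longrightarrow> gamma_finite (s + b h + 1)"
    and sa: "\<And>h. h \<in> {1..r} \<Longrightarrow> gamma_finite (s + a h + 1)"
    and ab: "\<And>h H K. h \<in> {1..r} \<Longrightarrow> H \<in> {1..q} \<Longrightarrow> K \<in> {1..m H - 1} \<Longrightarrow> gamma_finite (a h - (b H + of_nat K))"
    and d: "\<And>h. h \<in> {1..q} \<Longrightarrow> m h \<le> d"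
  shows "(\<Sum>j=1..q. \<Sum>k<d. B_coeff p q r a b \<kappa> n m j k * wcoef q r a b j (s + of_nat k)) = 0"
proof -
  let ?\<phi> = "(\<Prod>h=1..r. Gamma (s + a h + 1)) / (\<Prod>h=1..q. Gamma (s + b h + 1))"
  let ?V = "\<lambda>j k. shift_ratio q r a b s k / (s + of_nat k + b j + 1)"
  let ?\<pi> = "pi_coeff p q b \<kappa> n m" and ?w = "interp_weight q r a b"
  let ?t = "\<lambda>j H K k. tele_coeff q r a b j (b H + of_nat K) k"
  have inj: "inj_on b {1..q}"
    using b by (metis (no_types, lifting) Ints_0 cancel_comm_monoid_add_class.diff_cancel inj_onI)
  have tele: "(\<Sum>j=1..q. \<Sum>k<d. ?w j * ?t j H K k * ?V j k) = 1 / (s + 1 + (b H + of_nat K))"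
    if "H \<in> {1..q}" "K \<in> {1..m H - 1}" for H K
    by (rule telescoping_sum [OF \<open>r < q\<close> inj sb ab [OF _ that] that(1) refl])
       (use that d [OF that(1)] in auto)
  \<comment> \<open>Only k = 0 contributes, where \<open>shift_ratio\<close> is 1. For d = 0 the sum
    is empty and \<pi>_{j,0} is 0 by convention.\<close>
  have first: "(\<Sum>k<d. (if k = 0 then ?\<pi> j 0 else 0) * ?V j k) = ?\<pi> j 0 / (s + 1 + b j)"
    if "j \<in> {1..q}" for j
  proof (cases "d = 0")
    case True
    then show ?thesis using d [OF that] by (simp add: pi_coeff_def)
  next
    case False
    have "(\<Sum>k<d. (if k = 0 then ?\<pi> j 0 else 0) * ?V j k) = (\<Sum>k<d. if k = 0 then ?\<pi> j 0 * ?V j 0 else 0)"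
      by (rule sum.cong) auto
    also have "\<dots> = ?\<pi> j 0 * ?V j 0" using False by simp
    finally show ?thesis by (simp add: shift_ratio_def add_ac)
  qed
  have split: "(\<Sum>K<m H. f K) = (if 0 < m H then f 0 else 0) + (\<Sum>K=1..m H - 1. f K)"
    for H and f :: "nat \<Rightarrow> complex"
  proof (cases "m H")
    case (Suc N)
    then show ?thesis
      by (simp add: lessThan_Suc_atMost atMost_atLeast0 sum.atLeast_Suc_atMost)
  qed simp
  have "(\<Sum>j=1..q. \<Sum>k<d. B_coeff p q r a b \<kappa> n m j k * wcoef q r a b j (s + of_nat k)) =
      (\<Sum>j=1..q. \<Sum>k<d. ?\<phi> * (B_coeff p q r a b \<kappa> n m j k * ?V j k))"
    by (intro sum.cong refl) (simp only: wcoef_shift [OF sb sa] mult_ac)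
  also have "\<dots> = ?\<phi> * (\<Sum>j=1..q. \<Sum>k<d. B_coeff p q r a b \<kappa> n m j k * ?V j k)"
    by (simp only: sum_distrib_left)
  also have "(\<Sum>j=1..q. \<Sum>k<d. B_coeff p q r a b \<kappa> n m j k * ?V j k) =
      (\<Sum>j=1..q. \<Sum>k<d. (if k = 0 then ?\<pi> j 0 else 0) * ?V j k) +
      (\<Sum>j=1..q. \<Sum>k<d. \<Sum>H=1..q. \<Sum>K=1..m H - 1. ?\<pi> H K * (?w j * ?t j H K k * ?V j k))"
  proof -
    have "B_coeff p q r a b \<kappa> n m j k * ?V j k = (if k = 0 then ?\<pi> j 0 else 0) * ?V j k +
        (\<Sum>H=1..q. \<Sum>K=1..m H - 1. ?\<pi> H K * (?w j * ?t j H K k * ?V j k))" for j k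
    proof -
      have "?w j * (\<Sum>H=1..q. \<Sum>K=1..m H - 1. ?\<pi> H K * ?t j H K k) * ?V j k =
          (\<Sum>H=1..q. \<Sum>K=1..m H - 1. ?\<pi> H K * (?w j * ?t j H K k * ?V j k))"
        unfolding sum_distrib_left sum_distrib_right by (intro sum.cong refl) (simp only: mult_ac)
      then show ?thesis unfolding B_coeff_def by (simp only: distrib_right)
    qed
    then show ?thesis by (simp only: sum.distrib)
  qed
  also have "(\<Sum>j=1..q. \<Sum>k<d. (if k = 0 then ?\<pi> j 0 else 0) * ?V j k) = (\<Sum>j=1..q. ?\<pi> j 0 / (s + 1 + b j))"
    by (rule sum.cong [OF refl first])
  also have "(\<Sum>j=1..q. \<Sum>k<d. \<Sum>H=1..q. \<Sum>K=1..m H - 1. ?\<pi> H K * (?w j * ?t j H K k * ?V j k)) =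
      (\<Sum>H=1..q. \<Sum>K=1..m H - 1. \<Sum>j=1..q. \<Sum>k<d. ?\<pi> H K * (?w j * ?t j H K k * ?V j k))"
    by (rule sum_swap_dependent)
  also have "\<dots> = (\<Sum>H=1..q. \<Sum>K=1..m H - 1. ?\<pi> H K / (s + 1 + (b H + of_nat K)))"
  proof (intro sum.cong refl)
    fix H K assume HK: "H \<in> {1..q}" "K \<in> {1..m H - 1}"
    have "(\<Sum>j=1..q. \<Sum>k<d. ?\<pi> H K * (?w j * ?t j H K k * ?V j k)) =
        ?\<pi> H K * (\<Sum>j=1..q. \<Sum>k<d. ?w j * ?t j H K k * ?V j k)"
      by (simp only: sum_distrib_left)
    also have "\<dots> = ?\<pi> H K / (s + 1 + (b H + of_nat K))"
      unfolding tele [OF HK] by simp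
    finally show "(\<Sum>j=1..q. \<Sum>k<d. ?\<pi> H K * (?w j * ?t j H K k * ?V j k)) =
        ?\<pi> H K / (s + 1 + (b H + of_nat K))" .
  qed
  also have "(\<Sum>j=1..q. ?\<pi> j 0 / (s + 1 + b j)) + \<dots> =
      (\<Sum>H=1..q. \<Sum>K<m H. ?\<pi> H K / (s + 1 + (b H + of_nat K)))"
    unfolding split sum.distrib [symmetric]
    by (intro sum.cong refl) (auto simp: pi_coeff_def)
  also have "\<dots> = - (\<Prod>i=1..p. pochhammer (\<kappa> i - s) (n i)) / (\<Prod>h=1..q. pochhammer (s + 1 + b h) (m h))"
    by (rule pi_coeff_partial_fractions [OF b size sb])
  \<comment> \<open>The factor of index i is (-l)_{n_i} with l < n_i.\<close>
  also have "(\<Prod>i=1..p. pochhammer (\<kappa> i - s) (n i)) = 0"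
    using s by (intro prod_zero bexI [of _ i]) (auto simp: pochhammer_of_nat_eq_0_lemma)
  finally show ?thesis by simp
qed

text \<open>In component J the power z^(M-1) comes from the single pair (H,K) = (J, M-1): since m_H
  \<le> M, every other pair falls under \<open>tele_coeff_eq_0\<close>. \<open>nu_B\<close> is the
  reciprocal of this one contribution.\<close>

lemma B_lead_coeff:
  assumes b: "\<And>i h. i \<in> {1..q} \<Longrightarrow> h \<in> {1..q} \<Longrightarrow> i \<noteq> h \<Longrightarrow> b i - b h \<notin> \<int>"
    and J: "J = j_max q m" "J \<in> {1..q}" and M: "M = m_max q m" "m J = M" "0 < M"
    and m: "\<And>h. h \<in> {1..q} \<Longrightarrow> m h = M \<or> m h = M - 1"
    and aJ: "\<And>h. h \<in> {1..r} \<Longrightarrow> gamma_finite (a h - b J)"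
    and aM: "\<And>h. h \<in> {1..r} \<Longrightarrow> gamma_finite (a h - b J - (of_nat M - 1))"
    and \<kappa>: "\<And>i. i \<in> {1..p} \<Longrightarrow> gamma_finite (\<kappa> i + b J + of_nat M)"
  shows "nu_B p q r a b \<kappa> n m * B_coeff p q r a b \<kappa> n m J (M - 1) = 1"
proof -
  define N where "N = M - 1"
  have N: "M = Suc N" using M(3) by (simp add: N_def)
  let ?L = "{1..q} - {J}" and ?x = "b J + of_nat N"
  have bJ: "b h - b J \<noteq> 0" if "h \<in> ?L" for h
    using b [of h J] that J(2) by auto
  define ap where "ap = (\<Prod>h=1..r. pochhammer (a h - ?x) M)"
  define a1 where "a1 = (\<Prod>h=1..r. a h - b J)"
  define kp where "kp = (\<Prod>i=1..p. pochhammer (\<kappa> i + b J + of_nat M) (n i))"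
  define bm where "bm = (\<Prod>h\<in>?L. pochhammer (b h - ?x) (m h))"
  define bM where "bM = (\<Prod>h\<in>{h\<in>{1..q}. h \<noteq> J \<and> m h = M}. b h - b J)"
  define bN where "bN = (\<Prod>h\<in>{h\<in>{1..q}. h \<noteq> J \<and> m h = N}. b h - b J)"
  have nz: "ap \<noteq> 0" "a1 \<noteq> 0" "kp \<noteq> 0" "bm \<noteq> 0" "bM \<noteq> 0" "bN \<noteq> 0"
  proof -
    have "pochhammer (a h - ?x) M \<noteq> 0" if "h \<in> {1..r}" for h
      using gamma_finite_pochhammer_nonzero [OF aM [OF that], of M] by (simp add: N diff_diff_eq)
    then show "ap \<noteq> 0" unfolding ap_def by (subst prod_zero_iff) auto
    have "a h - b J \<noteq> 0" if "h \<in> {1..r}" for h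
      using aJ [OF that] by (auto simp: gamma_finite_def)
    then show "a1 \<noteq> 0" unfolding a1_def by (subst prod_zero_iff) auto
    show "kp \<noteq> 0" unfolding kp_def using \<kappa> gamma_finite_pochhammer_nonzero by (subst prod_zero_iff) auto
    have "pochhammer (b h - ?x) (m h) \<noteq> 0" if "h \<in> ?L" for h
    proof (rule pochhammer_nonzero_if_not_Int)
      show "b h - ?x \<notin> \<int>"
      proof
        assume "b h - ?x \<in> \<int>"
        then have "b h - ?x + of_nat N \<in> \<int>" by (intro Ints_add) auto
        then show False using b [of h J] that J(2) by simp
      qed
    qed
    then show "bm \<noteq> 0" unfolding bm_def by (subst prod_zero_iff) auto
    show "bM \<noteq> 0" "bN \<noteq> 0" unfolding bM_def bN_def using bJ by (subst prod_zero_iff; auto)+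
  qed
  have m': "m h = M \<or> m h = N" if "h \<in> {1..q}" for h
    using m [OF that] by (simp add: N)
  have L: "?L = {h\<in>{1..q}. h \<noteq> J \<and> m h = M} \<union> {h\<in>{1..q}. h \<noteq> J \<and> m h = N}"
    using m' by blast
  have bL: "(\<Prod>h\<in>?L. b h - b J) = bM * bN"
    unfolding L bM_def bN_def by (rule prod.union_disjoint) (auto simp: N)
  \<comment> \<open>Since x = b_J + N, the last factor of (b_h - x)_{N+1} is b_h - b_J; it exceeds
    the length m_h exactly when m_h = N.\<close>
  have bx: "(\<Prod>h\<in>?L. pochhammer (b h - ?x) (N + 1)) = bm * bN"
  proof -
    have "(\<Prod>h\<in>?L. pochhammer (b h - ?x) (N + 1)) =
        (\<Prod>h\<in>?L. pochhammer (b h - ?x) (m h) * (if m h = N then b h - b J else 1))"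
    proof (intro prod.cong refl)
      fix h assume "h \<in> ?L"
      then consider "m h = Suc N" | "m h = N" using m by (auto simp: N)
      then show "pochhammer (b h - ?x) (N + 1) =
          pochhammer (b h - ?x) (m h) * (if m h = N then b h - b J else 1)"
        by cases (simp_all add: pochhammer_Suc)
    qed
    also have "\<dots> = bm * (\<Prod>h\<in>?L. if m h = N then b h - b J else 1)"
      by (simp add: prod.distrib bm_def)
    also have "(\<Prod>h\<in>?L. if m h = N then b h - b J else 1) = bN"
      unfolding bN_def by (subst prod.inter_filter [symmetric]) (auto intro!: prod.cong)
    finally show ?thesis .
  qed
  have w: "interp_weight q r a b J = a1 / (bM * bN)"
    unfolding interp_weight_def a1_def bL ..
  have pJ: "pochhammer (b J - ?x) N = (-1) ^ N * fact N"
    using pochhammer_same [of N, where ?'a = complex] by simp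
  have t: "tele_coeff q r a b J ?x N = bm * bN * ((-1) ^ N * fact N) / ap"
    unfolding tele_coeff_def bx pJ by (simp add: ap_def N)
  have pi: "pi_coeff p q b \<kappa> n m J N = - (kp / ((-1) ^ N * fact N * bm))"
    using M(2) by (simp add: pi_coeff_def N kp_def bm_def diff_diff_eq add_ac)
  have BJ: "B_coeff p q r a b \<kappa> n m J N =
      interp_weight q r a b J * (pi_coeff p q b \<kappa> n m J N * tele_coeff q r a b J ?x N)"
  \<comment> \<open>For M = 1 no K \<ge> 1 occurs and \<pi>_{J,0} is the whole coefficient. It fits
    the same formula because \<open>interp_weight\<close> times \<open>tele_coeff\<close> is 1 at x
    = b_J, k = 0.\<close>
  proof (cases "N = 0")
    case True
    have "m H - 1 = 0" if "H \<in> {1..q}" for H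
      using m [OF that] True by (auto simp: N)
    moreover have "tele_coeff q r a b J (b J) 0 = bM * bN / a1"
      unfolding tele_coeff_def a1_def bL [symmetric] by simp
    ultimately show ?thesis
      using True w nz by (simp add: B_coeff_def)
  next
    case False
    have "(\<Sum>H=1..q. \<Sum>K=1..m H - 1. pi_coeff p q b \<kappa> n m H K * tele_coeff q r a b J (b H + of_nat K) N) =
        (\<Sum>H=1..q. \<Sum>K=1..m H - 1. if H = J \<and> K = N then pi_coeff p q b \<kappa> n m J N * tele_coeff q r a b J ?x N else 0)"
    proof (intro sum.cong refl)
      fix H K assume HK: "H \<in> {1..q}" "K \<in> {1..m H - 1}"
      show "pi_coeff p q b \<kappa> n m H K * tele_coeff q r a b J (b H + of_nat K) N =
        (if H = J \<and> K = N then pi_coeff p q b \<kappa> n m J N * tele_coeff q r a b J ?x N else 0)"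
      proof (cases "H = J \<and> K = N")
        case False
        have "tele_coeff q r a b J (b H + of_nat K) N = 0"
          by (rule tele_coeff_eq_0) (use HK False m [OF HK(1)] in \<open>auto simp: N\<close>)
        then show ?thesis by (simp only: False if_False mult_zero_right)
      qed auto
    qed
    also have "\<dots> = (\<Sum>H=1..q. if H = J then pi_coeff p q b \<kappa> n m J N * tele_coeff q r a b J ?x N else 0)"
    proof (intro sum.cong refl)
      fix H
      show "(\<Sum>K=1..m H - 1. if H = J \<and> K = N then pi_coeff p q b \<kappa> n m J N * tele_coeff q r a b J ?x N else 0) =
        (if H = J then pi_coeff p q b \<kappa> n m J N * tele_coeff q r a b J ?x N else 0)"
        using False M(2) by (cases "H = J") (simp_all add: N)
    qed
    also have "\<dots> = pi_coeff p q b \<kappa> n m J N * tele_coeff q r a b J ?x N"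
      using J(2) by simp
    finally show ?thesis using False by (simp add: B_coeff_def)
  qed
  have nu: "nu_B p q r a b \<kappa> n m = - (ap * bM / (a1 * kp))"
    unfolding nu_B_def Let_def J(1) [symmetric] M(1) [symmetric]
    by (simp add: ap_def bM_def a1_def kp_def N diff_diff_eq)
  show ?thesis
    unfolding N_def [symmetric] nu BJ w t pi using nz by (simp add: field_simps)
qed

section \<open>Uniqueness of the Gauss--Borel rows\<close>

lemma step_line_eq: "step_line d N i = N div d + of_bool (1 \<le> i \<and> i \<le> N mod d)"
proof -
  have "(\<Sum>\<alpha>=1..N mod d. of_bool (i = \<alpha>)) = (\<Sum>\<alpha>=1..N mod d. if \<alpha> = i then 1 else 0 :: nat)"
    by (rule sum.cong) auto
  then show ?thesis by (simp add: step_line_def)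
qed

text \<open>Row k d + (j - 1) carries z^k in component j, so the step-line entry counts the rows of
  component j among the first N. The cases locate k relative to the incomplete last block.\<close>

lemma less_step_line_iff:
  assumes "j \<in> {1..d}"
  shows "k < step_line d N j \<longleftrightarrow> k * d + (j - 1) < N"
proof -
  have d: "0 < d" using assms by simp
  have N: "N = N div d * d + N mod d" and lt: "N mod d < d" using d by simp_all
  consider "k < N div d" | "k = N div d" | "N div d < k" by linarith
  then show ?thesis
  proof cases
    case 1
    then have "(k + 1) * d \<le> N div d * d" by (intro mult_le_mono1) simp
    then have "k * d + d \<le> N div d * d" by (simp only: add_mult_distrib nat_mult_1)
    moreover have "j - 1 < d" using assms by auto
    ultimately have "k * d + (j - 1) < N" using N by linarith
    then show ?thesis using 1 by (simp add: step_line_eq)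
  next
    case 2
    have "k * d + (j - 1) < N \<longleftrightarrow> j - 1 < N mod d"
      using N unfolding 2 by linarith
    then show ?thesis using 2 assms by (auto simp: step_line_eq)
  next
    case 3
    then have "(N div d + 1) * d \<le> k * d" by (intro mult_le_mono1) simp
    then have "N div d * d + d \<le> k * d" by (simp only: add_mult_distrib nat_mult_1)
    then have "\<not> k * d + (j - 1) < N" using N lt by linarith
    then show ?thesis using 3 by (simp add: step_line_eq)
  qed
qed

lemma sum_step_line:
  fixes f :: "nat \<Rightarrow> nat \<Rightarrow> 'a :: comm_monoid_add"
  assumes d: "0 < d"
  shows "(\<Sum>N<L. f (N mod d + 1) (N div d)) = (\<Sum>j=1..d. \<Sum>k<step_line d L j. f j k)"
proof -
  let ?S = "Sigma {1..d} (\<lambda>j. {..<step_line d L j})"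
  have "(\<Sum>N<L. f (N mod d + 1) (N div d)) = (\<Sum>(j, k)\<in>?S. f j k)"
  proof (rule sum.reindex_bij_witness [of _ "\<lambda>(j, k). k * d + (j - 1)" "\<lambda>N. (N mod d + 1, N div d)"])
    fix N assume "N \<in> {..<L}"
    moreover have j: "N mod d + 1 \<in> {1..d}" using d by (simp add: Suc_le_eq)
    ultimately show "(N mod d + 1, N div d) \<in> ?S"
      using less_step_line_iff [OF j] by simp
  next
    fix x assume "x \<in> ?S"
    then obtain j k where x: "x = (j, k)" "j \<in> {1..d}" "k < step_line d L j" by auto
    show "(case x of (j, k) \<Rightarrow> k * d + (j - 1)) \<in> {..<L}"
      using x less_step_line_iff [OF x(2)] by simp
    have "j - 1 < d" using x(2) by auto
    then have "(k * d + (j - 1)) mod d = j - 1" "(k * d + (j - 1)) div d = k" by simp_all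
    then show "((case x of (j, k) \<Rightarrow> k * d + (j - 1)) mod d + 1, (case x of (j, k) \<Rightarrow> k * d + (j - 1)) div d) = x"
      using x(1,2) by (simp only: prod.case) simp
  qed simp_all
  also have "\<dots> = (\<Sum>j=1..d. \<Sum>k<step_line d L j. f j k)"
    by (subst sum.Sigma) auto
  finally show ?thesis .
qed

text \<open>The product S M equals H times the transposed inverse of Sbar, hence is upper
  triangular.\<close>

lemma gauss_borel_row_orthogonal:
  assumes gb: "gauss_borel M S H Sb" and L: "L < N"
  shows "(\<Sum>l\<le>N. S N l * M l L) = 0"
proof -
  obtain S' Sb' where inv: "ltri_inverse S S'" "ltri_inverse Sb Sb'"
    and M: "M = ltri_mult S' (ltri_mult H (\<lambda>k l. Sb' l k))"
    using gb unfolding gauss_borel_def by blast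
  define U where "U = ltri_mult H (\<lambda>k l. Sb' l k)"
  have low: "S' l t = 0" if "l < t" for l t
    using inv(1) that by (simp add: ltri_inverse_def lower_unitriangular_def)
  have SS': "(\<Sum>l\<le>N. S N l * S' l t) = of_bool (N = t)" for t
    using inv(1) by (simp add: ltri_inverse_def ltri_mult_def fun_eq_iff)
  have "M l L = (\<Sum>t\<le>N. S' l t * U t L)" if "l \<le> N" for l
  proof -
    have "M l L = (\<Sum>t\<le>l. S' l t * U t L)" by (simp add: M U_def ltri_mult_def)
    \<comment> \<open>Triangularity lets the inner sum run to N for every l; the double sum becomes
      rectangular and can be interchanged.\<close>
    also have "\<dots> = (\<Sum>t\<le>N. S' l t * U t L)"
      by (rule sum.mono_neutral_left) (use that low in auto)
    finally show ?thesis .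
  qed
  then have "(\<Sum>l\<le>N. S N l * M l L) = (\<Sum>l\<le>N. \<Sum>t\<le>N. S N l * S' l t * U t L)"
    by (simp add: sum_distrib_left mult.assoc)
  also have "\<dots> = (\<Sum>t\<le>N. \<Sum>l\<le>N. S N l * S' l t * U t L)" by (rule sum.swap)
  also have "\<dots> = (\<Sum>t\<le>N. of_bool (N = t) * U t L)"
    by (simp only: sum_distrib_right [symmetric] SS')
  also have "\<dots> = (\<Sum>t\<le>N. if t = N then U N L else 0)"
    by (rule sum.cong) auto
  also have "\<dots> = U N L" by simp
  also have "U N L = (\<Sum>t\<le>N. if t = N then H N N * Sb' L N else 0)"
    using gb unfolding U_def ltri_mult_def gauss_borel_def diagonal_matrix_def
    by (intro sum.cong) auto
  also have "\<dots> = H N N * Sb' L N" by simp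
  also have "Sb' L N = 0"
    using inv(2) L by (simp add: ltri_inverse_def lower_unitriangular_def)
  finally show ?thesis by simp
qed

lemma nonsingular_rows_independent:
  fixes A :: "nat \<Rightarrow> nat \<Rightarrow> complex"
  assumes "Determinant.det (Matrix.mat N N (\<lambda>(k, l). A k l)) \<noteq> 0"
    and "\<And>L. L < N \<Longrightarrow> (\<Sum>k<N. v k * A k L) = 0" and "k < N"
  shows "v k = 0"
proof -
  let ?A = "Matrix.mat N N (\<lambda>(k, l). A k l)" and ?v = "Matrix.vec N v"
  have carr: "transpose_mat ?A \<in> carrier_mat N N" by simp
  have "Determinant.det (transpose_mat ?A) \<noteq> 0"
    using assms(1) by (subst det_transpose) auto
  then have "\<not> (\<exists>v. v \<in> carrier_vec N \<and> v \<noteq> 0\<^sub>v N \<and> transpose_mat ?A *\<^sub>v v = 0\<^sub>v N)"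
    using det_0_iff_vec_prod_zero [OF carr] by simp
  moreover have "transpose_mat ?A *\<^sub>v ?v = 0\<^sub>v N"
  proof (rule eq_vecI)
    fix L assume "L < dim_vec (0\<^sub>v N)"
    then have L: "L < N" by simp
    then have "Matrix.vec_index (transpose_mat ?A *\<^sub>v ?v) L = (\<Sum>k<N. v k * A k L)"
      by (auto simp: scalar_prod_def atLeast0LessThan mult.commute intro!: sum.cong)
    then show "Matrix.vec_index (transpose_mat ?A *\<^sub>v ?v) L = Matrix.vec_index (0\<^sub>v N) L"
      using assms(2) [OF L] L by simp
  qed simp
  moreover have "?v \<in> carrier_vec N" by simp
  ultimately have "?v = 0\<^sub>v N" by blast
  then have "Matrix.vec_index ?v k = 0" using assms(3) by simp
  then show ?thesis using assms(3) by simp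
qed

text \<open>The difference of two candidate rows has last entry 0, so it is a left null vector of
  the nonsingular truncation of order N.\<close>

lemma gauss_borel_row_unique:
  assumes gb: "gauss_borel M S H Sb" and ns: "truncations_nonsingular M"
    and v: "v N = 1" "\<And>L. L < N \<Longrightarrow> (\<Sum>l\<le>N. v l * M l L) = 0" and l: "l \<le> N"
  shows "v l = S N l"
proof (cases "l = N")
  case True
  then show ?thesis using gb v(1) by (simp add: gauss_borel_def lower_unitriangular_def)
next
  case False
  have "S N N = 1" using gb by (simp add: gauss_borel_def lower_unitriangular_def)
  have "v l - S N l = 0"
  proof (rule nonsingular_rows_independent [where A = M and N = N])
    show "Determinant.det (Matrix.mat N N (\<lambda>(k, l). M k l)) \<noteq> 0"
      using ns by (simp add: truncations_nonsingular_def)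
    fix L assume L: "L < N"
    have "(\<Sum>k<N. (v k - S N k) * M k L) = (\<Sum>k\<le>N. (v k - S N k) * M k L)"
      using v(1) \<open>S N N = 1\<close> by (simp add: lessThan_Suc_atMost [symmetric])
    also have "\<dots> = 0"
      using v(2) [OF L] gauss_borel_row_orthogonal [OF gb L]
      by (simp add: left_diff_distrib sum_subtractf)
    finally show "(\<Sum>k<N. (v k - S N k) * M k L) = 0" .
  qed (use l False in auto)
  then show ?thesis by simp
qed

lemma sum_block_col:
  assumes "0 < d"
  shows "(\<Sum>i=1..d. block_col d z L i * f i) = z ^ (L div d) * f (L mod d + 1)"
proof -
  have "(\<Sum>i=1..d. block_col d z L i * f i) =
      (\<Sum>i=1..d. if i = L mod d + 1 then z ^ (L div d) * f (L mod d + 1) else 0)"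
    by (rule sum.cong) (auto simp: block_col_def)
  moreover have "L mod d + 1 \<in> {1..d}" using assms by (simp add: Suc_le_eq)
  ultimately show ?thesis by (simp only: sum.delta finite_atLeastAtMost if_True)
qed

lemma moment_matrix_eq:
  assumes "0 < p" "0 < q" "r < q" "weight_admissible p q r a b \<kappa>"
  shows "moment_matrix p q r a b \<kappa> N L =
     wcoef q r a b (N mod q + 1) (of_nat (N div q + L div p) + \<kappa> (L mod p + 1))"
proof -
  let ?j = "N mod q + 1" and ?i = "L mod p + 1"
  have j: "?j \<in> {1..q}" and i: "?i \<in> {1..p}" using assms(1,2) by (simp_all add: Suc_le_eq)
  \<comment> \<open>The one-term sum equals 1 and only supplies the shape of
    \<open>circ_integral_weight\<close>.\<close>
  have "(\<Sum>j=1..q. \<Sum>i=1..p. block_col q z N j * weight q r a b \<kappa> j i z * block_col p z L i) =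
      z ^ (N div q + L div p) * weight q r a b \<kappa> ?j ?i z * (\<Sum>k<1. 1 * z ^ k)" for z
  proof -
    have "(\<Sum>j=1..q. \<Sum>i=1..p. block_col q z N j * weight q r a b \<kappa> j i z * block_col p z L i) =
        (\<Sum>j=1..q. block_col q z N j * (\<Sum>i=1..p. block_col p z L i * weight q r a b \<kappa> j i z))"
      by (simp add: sum_distrib_left mult_ac)
    also have "\<dots> = z ^ (N div q) * (z ^ (L div p) * weight q r a b \<kappa> ?j ?i z)"
      unfolding sum_block_col [OF assms(1)] sum_block_col [OF assms(2)] ..
    finally show ?thesis by (simp add: power_add)
  qed
  then show ?thesis
    unfolding moment_matrix_def
    by (simp only: circ_integral_weight [OF assms(3,4) i j]) simp
qed

section \<open>Biorthogonality\<close>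

lemma m_min_facts:
  assumes "1 \<le> q" "near_diagonal q m"
  shows "j_min q m \<in> {1..q}" "m (j_min q m) = m_min q m"
    "\<And>h. h \<in> {1..q} \<Longrightarrow> m h = m_min q m \<or> m h = m_min q m + 1"
proof -
  have "m_min q m \<in> m ` {1..q}" unfolding m_min_def using assms(1) by (intro Min_in) auto
  then have "{j \<in> {1..q}. m j = m_min q m} \<noteq> {}" by auto
  then have J: "j_min q m \<in> {j \<in> {1..q}. m j = m_min q m}"
    unfolding j_min_def by (intro Min_in) auto
  then show j: "j_min q m \<in> {1..q}" "m (j_min q m) = m_min q m" by auto
  fix h assume h: "h \<in> {1..q}"
  have "m_min q m \<le> m h" unfolding m_min_def using h by (intro Min_le) auto
  then show "m h = m_min q m \<or> m h = m_min q m + 1"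
    using near_diagonal_le_Suc [OF assms(2) j(1) h] j(2) by linarith
qed

lemma m_max_facts:
  assumes "1 \<le> q" "near_diagonal q m"
  shows "j_max q m \<in> {1..q}" "m (j_max q m) = m_max q m"
    "\<And>h. h \<in> {1..q} \<Longrightarrow> m h = m_max q m \<or> m h = m_max q m - 1"
    "\<And>h. h \<in> {1..q} \<Longrightarrow> m h \<le> m_max q m"
proof -
  have "m_max q m \<in> m ` {1..q}" unfolding m_max_def using assms(1) by (intro Max_in) auto
  then have "{j \<in> {1..q}. m j = m_max q m} \<noteq> {}" by auto
  then have J: "j_max q m \<in> {j \<in> {1..q}. m j = m_max q m}"
    unfolding j_max_def by (intro Max_in) auto
  then show j: "j_max q m \<in> {1..q}" "m (j_max q m) = m_max q m" by auto
  fix h assume h: "h \<in> {1..q}"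
  show le: "m h \<le> m_max q m" unfolding m_max_def using h by (intro Max_ge) auto
  show "m h = m_max q m \<or> m h = m_max q m - 1"
    using le near_diagonal_le_Suc [OF assms(2) h j(1)] j(2) by linarith
qed

lemma circ_integral_A_comp:
  assumes "r < q" "weight_admissible p q r a b \<kappa>" "i \<in> {1..p}" "j \<in> {1..q}"
  shows "circ_integral (\<lambda>z. z ^ l * weight q r a b \<kappa> j i z * A_comp p q r a b \<kappa> n m \<nu> i z) =
     \<nu> * (\<Sum>k<n i. A_coeff p q r a b \<kappa> n m i k * wcoef q r a b j (of_nat (k + l) + \<kappa> i))"
  unfolding A_comp_eq_sum circ_integral_weight [OF assms] by (simp only: sum_distrib_left mult.assoc)

lemma A_part:
  assumes q: "1 \<le> q" and reg: "regular_params p q r b \<kappa>"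
    and size: "vec_size p n = vec_size q m + 1" and nd: "near_diagonal q m"
    and adm: "A_admissible p q r a b \<kappa> n m"
  shows "j \<in> {1..q} \<Longrightarrow> l < m j \<Longrightarrow>
      (\<Sum>i=1..p. circ_integral (\<lambda>z. z ^ l * weight q r a b \<kappa> j i z * A_comp p q r a b \<kappa> n m \<nu> i z)) = 0"
    and "(\<Sum>i=1..p. circ_integral (\<lambda>z. z ^ m_min q m * weight q r a b \<kappa> (j_min q m) i z *
          A_comp p q r a b \<kappa> n m (nu_A p q r a b \<kappa> n m) i z)) = 1"
proof -
  define J where "J = j_min q m"
  define M where "M = m_min q m"
  have rq: "r < q"
    and b: "\<And>i h. i \<in> {1..q} \<Longrightarrow> h \<in> {1..q} \<Longrightarrow> i \<noteq> h \<Longrightarrow> b i - b h \<notin> \<int>"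
    and \<kappa>: "\<And>i h. i \<in> {1..p} \<Longrightarrow> h \<in> {1..p} \<Longrightarrow> i \<noteq> h \<Longrightarrow> \<kappa> i - \<kappa> h \<notin> \<int>"
    using reg by (auto simp: regular_params_def)
  have wadm: "weight_admissible p q r a b \<kappa>"
    and bf: "\<And>i h. i \<in> {1..p} \<Longrightarrow> 1 \<le> n i \<Longrightarrow> h \<in> {1..q} \<Longrightarrow> gamma_finite (\<kappa> i + b h + 1)"
    and af: "\<And>i h. i \<in> {1..p} \<Longrightarrow> 1 \<le> n i \<Longrightarrow> h \<in> {1..r} \<Longrightarrow> gamma_finite (\<kappa> i + a h + 1)"
    using adm unfolding A_admissible_def by blast+
  have \<kappa>J: "gamma_finite (\<kappa> i + b J + of_nat M + 1)" if "i \<in> {1..p}" for i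
    using adm that unfolding A_admissible_def Let_def J_def M_def poch_adm_def by blast
  have aJ: "gamma_finite (a h - b J - of_nat M)" if "h \<in> {1..r}" for h
    using adm that unfolding A_admissible_def Let_def J_def M_def poch_adm_def by blast
  note mm = m_min_facts [OF q nd, folded J_def M_def]
  have circ: "(\<Sum>i=1..p. circ_integral (\<lambda>z. z ^ l * weight q r a b \<kappa> j i z * A_comp p q r a b \<kappa> n m \<nu> i z)) =
     \<nu> * (\<Sum>i=1..p. \<Sum>k<n i. A_coeff p q r a b \<kappa> n m i k * wcoef q r a b j (of_nat (k + l) + \<kappa> i))"
    if "j \<in> {1..q}" for j l \<nu>
    unfolding sum_distrib_left [of \<nu>]
    by (intro sum.cong refl) (simp only: circ_integral_A_comp [OF rq wadm _ that] sum_distrib_left)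
  show "(\<Sum>i=1..p. circ_integral (\<lambda>z. z ^ l * weight q r a b \<kappa> j i z * A_comp p q r a b \<kappa> n m \<nu> i z)) = 0"
    if jl: "j \<in> {1..q}" "l < m j" for j l
  proof -
    \<comment> \<open>From l < m_j and m_j \<le> m_h + 1: near the diagonal all Gamma quotients
      become polynomial at once.\<close>
    have "l \<le> m h" if "h \<in> {1..q}" for h
      using near_diagonal_le_Suc [OF nd that jl(1)] jl(2) by linarith
    then show ?thesis
      unfolding circ [OF jl(1)]
      by (subst A_orthogonality) (use \<kappa> bf af size rq jl in auto)
  qed
  define X where "X = (\<Prod>h=1..r. pochhammer (a h - b J - of_nat M) M)"
  define Y where "Y = (\<Prod>h\<in>{h\<in>{1..q}. m h = M + 1}. b h - b J)"
  define Z where "Z = (\<Prod>i=1..p. pochhammer (\<kappa> i + b J + of_nat M + 1) (n i))"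
  have nz: "X \<noteq> 0" "Y \<noteq> 0" "Z \<noteq> 0"
  proof -
    show "X \<noteq> 0" unfolding X_def using aJ gamma_finite_pochhammer_nonzero by (subst prod_zero_iff) auto
    show "Z \<noteq> 0" unfolding Z_def using \<kappa>J gamma_finite_pochhammer_nonzero by (subst prod_zero_iff) auto
    have "b h - b J \<noteq> 0" if "h \<in> {1..q}" "m h = M + 1" for h
      using b [of h J] that mm(1,2) by (metis Ints_0 add_eq_self_zero one_neq_zero)
    then show "Y \<noteq> 0" unfolding Y_def by (subst prod_zero_iff) auto
  qed
  have "(\<Sum>i=1..p. \<Sum>k<n i. A_coeff p q r a b \<kappa> n m i k * wcoef q r a b J (of_nat (k + M) + \<kappa> i)) =
     - (X * Y) / Z"
    unfolding X_def Y_def Z_def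
    by (rule A_normalization [where \<kappa> = \<kappa> and a = a and b = b and n = n and m = m
        and J = J and M = M, OF \<kappa> bf af gamma_finite_pochhammer_nonzero [OF \<kappa>J] size rq mm])
  moreover have "nu_A p q r a b \<kappa> n m = - (Z / (X * Y))"
    unfolding nu_A_def Let_def J_def [symmetric] M_def [symmetric] X_def Y_def Z_def ..
  ultimately show "(\<Sum>i=1..p. circ_integral (\<lambda>z. z ^ m_min q m * weight q r a b \<kappa> (j_min q m) i z *
          A_comp p q r a b \<kappa> n m (nu_A p q r a b \<kappa> n m) i z)) = 1"
    unfolding J_def [symmetric] M_def [symmetric] circ [OF mm(1)] using nz by simp
qed

text \<open>Two sources are needed. For m_h > 0 the symbols of \<pi>_{h,0} give the claim. For m_h =
  0 it comes from a weight C_{j,i} with j \<noteq> h, whose unit vector leaves index h unshifted;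
  such a j exists because |m| \<ge> 1.\<close>

lemma B_admissible_gamma_finite:
  assumes adm: "B_admissible p q r a b \<kappa> n m" and size: "vec_size q m = vec_size p n + 1"
    and i: "i \<in> {1..p}" and h: "h \<in> {1..q}"
  shows "gamma_finite (\<kappa> i + b h + 1)"
proof (cases "m h = 0")
  case False
  then have "poch_adm (\<kappa> i + b h + of_nat 0 + 1) (n i)"
    using adm i h unfolding B_admissible_def by blast
  then show ?thesis by (simp add: poch_adm_def)
next
  case True
  have "vec_size q m \<noteq> 0" using size by simp
  then obtain j where j: "j \<in> {1..q}" "m j \<noteq> 0"
    unfolding vec_size_def by (auto elim: sum.not_neutral_contains_not_neutral)
  then have "h \<noteq> j" using True by auto
  have "weight_admissible p q r a b \<kappa>" using adm by (simp add: B_admissible_def)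
  then have "gamma_finite (of_nat 0 + \<kappa> i + b h + of_bool (h = j) + 1)"
    using i h j(1) unfolding weight_admissible_def by blast
  then show ?thesis using \<open>h \<noteq> j\<close> by simp
qed

lemma B_admissible_orthogonality:
  assumes q: "1 \<le> q" and reg: "regular_params p q r b \<kappa>"
    and size: "vec_size q m = vec_size p n + 1" and nd: "near_diagonal q m"
    and adm: "B_admissible p q r a b \<kappa> n m"
    and i: "i \<in> {1..p}" and l: "l < n i"
  shows "(\<Sum>j=1..q. \<Sum>k<m j. B_coeff p q r a b \<kappa> n m j k * wcoef q r a b j (of_nat (k + l) + \<kappa> i)) = 0"
proof -
  let ?d = "m_max q m" and ?s = "of_nat l + \<kappa> i"
  note mm = m_max_facts [OF q nd]
  have rq: "r < q"
    and b: "\<And>i h. i \<in> {1..q} \<Longrightarrow> h \<in> {1..q} \<Longrightarrow> i \<noteq> h \<Longrightarrow> b i - b h \<notin> \<int>"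
    using reg by (auto simp: regular_params_def)
  have sb: "gamma_finite (?s + b h + 1)" if "h \<in> {1..q}" for h
    using gamma_finite_add [OF B_admissible_gamma_finite [OF adm size i that], of l] by (simp add: add_ac)
  have "weight_admissible p q r a b \<kappa>" using adm by (simp add: B_admissible_def)
  then have sa: "gamma_finite (?s + a h + 1)" if "h \<in> {1..r}" for h
    using i mm(1) that unfolding weight_admissible_def by blast
  have ab: "gamma_finite (a h - (b H + of_nat K))"
    if "h \<in> {1..r}" "H \<in> {1..q}" "K \<in> {1..m H - 1}" for h H K
  proof -
    have "1 \<le> m H" using that(3) by auto
    then have "poch_adm (a h - (b H + of_nat K)) 1"
      using adm that unfolding B_admissible_def by blast
    then show ?thesis by (simp add: poch_adm_def)
  qed
  \<comment> \<open>Telescoping needs one range of powers for all components. It is run up to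
    \<open>m_max\<close> and then cut back to m_j, beyond which the coefficients vanish.\<close>
  have "(\<Sum>j=1..q. \<Sum>k<?d. B_coeff p q r a b \<kappa> n m j k * wcoef q r a b j (?s + of_nat k)) = 0"
    by (rule B_orthogonality [where s = ?s and i = i and l = l and \<kappa> = \<kappa> and a = a and b = b
        and n = n and m = m and d = ?d, OF b size rq refl i l sb sa ab mm(4)])
  moreover have "(\<Sum>k<?d. B_coeff p q r a b \<kappa> n m j k * wcoef q r a b j (?s + of_nat k)) =
      (\<Sum>k<m j. B_coeff p q r a b \<kappa> n m j k * wcoef q r a b j (of_nat (k + l) + \<kappa> i))"
    if j: "j \<in> {1..q}" for j
  proof -
    have "(\<Sum>k<?d. B_coeff p q r a b \<kappa> n m j k * wcoef q r a b j (?s + of_nat k)) =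
      (\<Sum>k<m j. B_coeff p q r a b \<kappa> n m j k * wcoef q r a b j (?s + of_nat k))"
      by (rule sum.mono_neutral_right) (use mm(4) [OF j] B_coeff_eq_0 [OF nd j] in auto)
    then show ?thesis by (simp add: add_ac)
  qed
  ultimately show ?thesis by simp
qed

lemma B_admissible_lead_coeff:
  assumes q: "1 \<le> q" and reg: "regular_params p q r b \<kappa>"
    and size: "vec_size q m = vec_size p n + 1" and nd: "near_diagonal q m"
    and adm: "B_admissible p q r a b \<kappa> n m"
  shows "nu_B p q r a b \<kappa> n m * B_coeff p q r a b \<kappa> n m (j_max q m) (m_max q m - 1) = 1"
    and "0 < m_max q m"
proof -
  note mm = m_max_facts [OF q nd]
  have b: "\<And>i h. i \<in> {1..q} \<Longrightarrow> h \<in> {1..q} \<Longrightarrow> i \<noteq> h \<Longrightarrow> b i - b h \<notin> \<int>"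
    using reg by (auto simp: regular_params_def)
  show pos: "0 < m_max q m"
  proof (rule ccontr)
    assume "\<not> 0 < m_max q m"
    then have "vec_size q m = 0" using mm(4) by (auto simp: vec_size_def)
    then show False using size by simp
  qed
  have "gamma_finite (a h - b (j_max q m))"
    "gamma_finite (a h - b (j_max q m) - (of_nat (m_max q m) - 1))" if "h \<in> {1..r}" for h
    using adm that unfolding B_admissible_def Let_def poch_adm_def by blast+
  moreover have "gamma_finite (\<kappa> i + b (j_max q m) + of_nat (m_max q m))" if "i \<in> {1..p}" for i
    using adm that unfolding B_admissible_def Let_def poch_adm_def by blast
  ultimately show "nu_B p q r a b \<kappa> n m * B_coeff p q r a b \<kappa> n m (j_max q m) (m_max q m - 1) = 1"
    by (intro B_lead_coeff b refl mm pos)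
qed

text \<open>Row N is the last of the first N + 1 rows: its block is the highest one, and later
  positions in that block are still unfilled. Taking the last maximal index in \<open>j_max\<close>
  therefore selects the monic component r_N.\<close>

lemma m_max_step_line:
  assumes "1 \<le> q" and m: "\<And>j. j \<in> {1..q} \<Longrightarrow> m j = step_line q (N + 1) j"
  shows "m_max q m = N div q + 1" "j_max q m = N mod q + 1"
proof -
  let ?J = "N mod q + 1"
  have J: "?J \<in> {1..q}" using assms(1) by (simp add: Suc_le_eq)
  have less: "k < m j \<longleftrightarrow> k * q + (j - 1) < N + 1" if "j \<in> {1..q}" for k j
    using less_step_line_iff [OF that] m [OF that] by simp
  have N: "N = N div q * q + N mod q" and lt: "N mod q < q" using assms(1) by simp_all
  have le: "m j \<le> N div q + 1" if "j \<in> {1..q}" for j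
  proof -
    have "(N div q + 1) * q = N div q * q + q" by (simp only: add_mult_distrib nat_mult_1)
    then have "\<not> (N div q + 1) * q + (j - 1) < N + 1" using N lt by linarith
    then show ?thesis using less [OF that, of "N div q + 1"] by simp
  qed
  have "N div q < m ?J" using less [OF J, of "N div q"] by simp
  then have mJ: "m ?J = N div q + 1" using le [OF J] by simp
  show max: "m_max q m = N div q + 1"
    unfolding m_max_def
  proof (rule Max_eqI)
    show "N div q + 1 \<in> m ` {1..q}" using mJ J by (metis imageI)
  qed (use le in auto)
  show "j_max q m = ?J"
    unfolding j_max_def max
  proof (rule Max_eqI)
    fix j assume "j \<in> {j \<in> {1..q}. m j = N div q + 1}"
    then have j: "j \<in> {1..q}" "N div q < m j" by auto
    then have "N div q * q + (j - 1) < N + 1" using less by blast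
    then show "j \<le> ?J" using N by linarith
  qed (use mJ J in auto)
qed

lemma B_step_line:
  assumes p: "1 \<le> p" and q: "1 \<le> q" and reg: "regular_params p q r b \<kappa>"
    and size: "vec_size q m = vec_size p n + 1" and nd: "near_diagonal q m"
    and adm: "B_admissible p q r a b \<kappa> n m"
    and n: "\<And>i. i \<in> {1..p} \<Longrightarrow> n i = step_line p N i"
    and m: "\<And>j. j \<in> {1..q} \<Longrightarrow> m j = step_line q (N + 1) j"
    and ns: "truncations_nonsingular (moment_matrix p q r a b \<kappa>)"
    and gb: "gauss_borel (moment_matrix p q r a b \<kappa>) S H Sb"
    and j: "j \<in> {1..q}"
  shows "B_comp p q r a b \<kappa> n m (nu_B p q r a b \<kappa> n m) j z = ltri_mult S (block_col q z) N j"
proof -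
  let ?\<nu> = "nu_B p q r a b \<kappa> n m"
  \<comment> \<open>The coefficients of B in scalar row order; entry N is the leading coefficient of
    the monic component.\<close>
  define v where "v l = ?\<nu> * B_coeff p q r a b \<kappa> n m (l mod q + 1) (l div q)" for l
  have rq: "r < q" using reg by (simp add: regular_params_def)
  have wadm: "weight_admissible p q r a b \<kappa>" using adm by (simp add: B_admissible_def)
  have vN: "v N = 1"
    using B_admissible_lead_coeff(1) [OF q reg size nd adm] m_max_step_line [of q m N, OF q m]
    by (simp add: v_def)
  have orth: "(\<Sum>l\<le>N. v l * moment_matrix p q r a b \<kappa> l L) = 0" if L: "L < N" for L
  proof -
    let ?i = "L mod p + 1" and ?l = "L div p"
    have i: "?i \<in> {1..p}" using p by (simp add: Suc_le_eq)
    \<comment> \<open>Column L tests against z^(L div p) in component L mod p + 1, and L < N places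
      this power within the orthogonality range of \<sigma>_p(N).\<close>
    have l: "?l < n ?i" using less_step_line_iff [OF i] n [OF i] L by simp
    have "(\<Sum>l\<le>N. v l * moment_matrix p q r a b \<kappa> l L) =
        (\<Sum>l<N+1. ?\<nu> * (B_coeff p q r a b \<kappa> n m (l mod q + 1) (l div q) *
           wcoef q r a b (l mod q + 1) (of_nat (l div q + ?l) + \<kappa> ?i)))"
      using p q rq wadm by (simp add: v_def moment_matrix_eq lessThan_Suc_atMost mult.assoc)
    also have "\<dots> = (\<Sum>j=1..q. \<Sum>k<m j. ?\<nu> * (B_coeff p q r a b \<kappa> n m j k *
           wcoef q r a b j (of_nat (k + ?l) + \<kappa> ?i)))"
      using q by (subst sum_step_line) (simp_all add: m)
    also have "\<dots> = ?\<nu> * (\<Sum>j=1..q. \<Sum>k<m j. B_coeff p q r a b \<kappa> n m j k *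
           wcoef q r a b j (of_nat (k + ?l) + \<kappa> ?i))"
      by (simp only: sum_distrib_left)
    finally show ?thesis unfolding B_admissible_orthogonality [OF q reg size nd adm i l] by simp
  qed
  have "ltri_mult S (block_col q z) N j = (\<Sum>l\<le>N. v l * block_col q z l j)"
    unfolding ltri_mult_def
    by (intro sum.cong refl) (simp add: gauss_borel_row_unique [OF gb ns vN orth])
  also have "\<dots> = (\<Sum>l<N+1. ?\<nu> * B_coeff p q r a b \<kappa> n m (l mod q + 1) (l div q) *
      (if j = l mod q + 1 then z ^ (l div q) else 0))"
    by (simp add: v_def block_col_def lessThan_Suc_atMost)
  also have "\<dots> = (\<Sum>j'=1..q. \<Sum>k<m j'. ?\<nu> * B_coeff p q r a b \<kappa> n m j' k * (if j = j' then z ^ k else 0))"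
    using q by (subst sum_step_line) (simp_all add: m)
  also have "\<dots> = (\<Sum>j'=1..q. if j' = j then \<Sum>k<m j. ?\<nu> * B_coeff p q r a b \<kappa> n m j k * z ^ k else 0)"
    by (intro sum.cong refl) auto
  also have "\<dots> = B_comp p q r a b \<kappa> n m ?\<nu> j z"
    using j by (simp add: B_comp_eq_sum [OF nd j order_refl])
  finally show ?thesis ..
qed

lemma circ_integral_B_comp:
  assumes "r < q" "weight_admissible p q r a b \<kappa>" "i \<in> {1..p}" "j \<in> {1..q}" "near_diagonal q m"
  shows "circ_integral (\<lambda>z. z ^ l * B_comp p q r a b \<kappa> n m \<nu> j z * weight q r a b \<kappa> j i z) =
     \<nu> * (\<Sum>k<m j. B_coeff p q r a b \<kappa> n m j k * wcoef q r a b j (of_nat (k + l) + \<kappa> i))"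
proof -
  have "z ^ l * B_comp p q r a b \<kappa> n m \<nu> j z * weight q r a b \<kappa> j i z =
      z ^ l * weight q r a b \<kappa> j i z * (\<Sum>k<m j. \<nu> * B_coeff p q r a b \<kappa> n m j k * z ^ k)" for z
    unfolding B_comp_eq_sum [OF assms(5,4) order_refl] by (simp only: mult_ac)
  then show ?thesis
    by (simp only: circ_integral_weight [OF assms(1-4)]) (simp only: sum_distrib_left mult.assoc)
qed

theorem theorem4p1:
  fixes p q r :: nat
    and a b \<kappa> :: "nat \<Rightarrow> complex"
    and n m :: "nat \<Rightarrow> nat"
  assumes "p \<ge> 1" and "q \<ge> 1"
    and "regular_params p q r b \<kappa>"
  shows
    "(vec_size p n = vec_size q m + 1 \<and> near_diagonal q m \<and> A_admissible p q r a b \<kappa> n m \<longrightarrow>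
       (\<forall>\<nu>. \<nu> \<noteq> 0 \<longrightarrow>
          (\<forall>i\<in>{1..p}. 1 \<le> n i \<longrightarrow>
             (\<forall>k\<ge>n i. fps_nth (fps_hypergeo (A_upper p q b \<kappa> n m i) (A_lower p r a \<kappa> i) 1) k = 0) \<and>
             (\<exists>P. degree P \<le> n i - 1 \<and> (\<forall>z. A_comp p q r a b \<kappa> n m \<nu> i z = poly P z))) \<and>
          (\<forall>j\<in>{1..q}. \<forall>l<m j.
             (\<Sum>i=1..p. circ_integral (\<lambda>z.
                z ^ l * weight q r a b \<kappa> j i z * A_comp p q r a b \<kappa> n m \<nu> i z)) = 0)) \<and>
       (\<Sum>i=1..p. circ_integral (\<lambda>z.
          z ^ m_min q m * weight q r a b \<kappa> (j_min q m) i z *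
          A_comp p q r a b \<kappa> n m (nu_A p q r a b \<kappa> n m) i z)) = 1)
     \<and>
     (vec_size q m = vec_size p n + 1 \<and> near_diagonal q m \<and> B_admissible p q r a b \<kappa> n m \<longrightarrow>
       (\<forall>j\<in>{1..q}. 1 \<le> m j \<longrightarrow>
          pi_coeff p q b \<kappa> n m j 0 =
            - ((\<Prod>i=1..p. pochhammer (\<kappa> i + b j + 1) (n i)) /
               (fact (m j - 1) * (\<Prod>I\<in>{1..q}-{j}. pochhammer (b I - b j) (m I))))) \<and>
       (\<forall>\<nu>. \<nu> \<noteq> 0 \<longrightarrow>
          (\<forall>j\<in>{1..q}. 1 \<le> m j \<longrightarrow>
             (\<exists>P. degree P \<le> m j - 1 \<and> (\<forall>z. B_comp p q r a b \<kappa> n m \<nu> j z = poly P z))) \<and>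
          (\<forall>i\<in>{1..p}. \<forall>l<n i.
             (\<Sum>j=1..q. circ_integral (\<lambda>z.
                z ^ l * B_comp p q r a b \<kappa> n m \<nu> j z * weight q r a b \<kappa> j i z)) = 0)) \<and>
       (\<exists>P. degree P = m_max q m - 1 \<and> lead_coeff P = 1 \<and>
          (\<forall>z. B_comp p q r a b \<kappa> n m (nu_B p q r a b \<kappa> n m) (j_max q m) z = poly P z)) \<and>
       (\<forall>N. (\<forall>i\<in>{1..p}. n i = step_line p N i) \<and> (\<forall>j\<in>{1..q}. m j = step_line q (N + 1) j) \<and>
          truncations_nonsingular (moment_matrix p q r a b \<kappa>) \<longrightarrow>
          (\<forall>S H Sb. gauss_borel (moment_matrix p q r a b \<kappa>) S H Sb \<longrightarrow>
             (\<forall>j\<in>{1..q}. \<forall>z.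
                B_comp p q r a b \<kappa> n m (nu_B p q r a b \<kappa> n m) j z =
                ltri_mult S (block_col q z) N j))))"
proof (intro conjI impI)
  note reg = assms(3)
  have rq: "r < q" using reg by (simp add: regular_params_def)
  {
    assume *: "vec_size p n = vec_size q m + 1 \<and> near_diagonal q m \<and> A_admissible p q r a b \<kappa> n m"
    note A = A_part [OF assms(2) reg *[THEN conjunct1] *[THEN conjunct2, THEN conjunct1] *[THEN conjunct2, THEN conjunct2]]
    show "\<forall>\<nu>. \<nu> \<noteq> 0 \<longrightarrow>
          (\<forall>i\<in>{1..p}. 1 \<le> n i \<longrightarrow>
             (\<forall>k\<ge>n i. fps_nth (fps_hypergeo (A_upper p q b \<kappa> n m i) (A_lower p r a \<kappa> i) 1) k = 0) \<and>
             (\<exists>P. degree P \<le> n i - 1 \<and> (\<forall>z. A_comp p q r a b \<kappa> n m \<nu> i z = poly P z))) \<and>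
          (\<forall>j\<in>{1..q}. \<forall>l<m j.
             (\<Sum>i=1..p. circ_integral (\<lambda>z.
                z ^ l * weight q r a b \<kappa> j i z * A_comp p q r a b \<kappa> n m \<nu> i z)) = 0)"
    proof (intro allI impI conjI ballI)
      fix \<nu> :: complex and i assume "1 \<le> n i"
      then show "fps_nth (fps_hypergeo (A_upper p q b \<kappa> n m i) (A_lower p r a \<kappa> i) 1) k = 0"
        if "n i \<le> k" for k
        using that by (rule A_series_terminates)
      show "\<exists>P. degree P \<le> n i - 1 \<and> (\<forall>z. A_comp p q r a b \<kappa> n m \<nu> i z = poly P z)"
        unfolding A_comp_eq_sum
        by (rule poly_of_coeffs [of "n i" "\<lambda>k. \<nu> * A_coeff p q r a b \<kappa> n m i k"]) auto
    qed (rule A(1))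
    show "(\<Sum>i=1..p. circ_integral (\<lambda>z.
          z ^ m_min q m * weight q r a b \<kappa> (j_min q m) i z *
          A_comp p q r a b \<kappa> n m (nu_A p q r a b \<kappa> n m) i z)) = 1"
      by (rule A(2))
  }
  assume *: "vec_size q m = vec_size p n + 1 \<and> near_diagonal q m \<and> B_admissible p q r a b \<kappa> n m"
  then have size: "vec_size q m = vec_size p n + 1" and nd: "near_diagonal q m"
    and adm: "B_admissible p q r a b \<kappa> n m" by auto
  have wadm: "weight_admissible p q r a b \<kappa>" using adm by (simp add: B_admissible_def)
  note mm = m_max_facts [OF assms(2) nd]
  show "\<forall>j\<in>{1..q}. 1 \<le> m j \<longrightarrow>
          pi_coeff p q b \<kappa> n m j 0 =
            - ((\<Prod>i=1..p. pochhammer (\<kappa> i + b j + 1) (n i)) /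
               (fact (m j - 1) * (\<Prod>I\<in>{1..q}-{j}. pochhammer (b I - b j) (m I))))"
    by (simp add: pi_coeff_def)
  show "\<forall>\<nu>. \<nu> \<noteq> 0 \<longrightarrow>
          (\<forall>j\<in>{1..q}. 1 \<le> m j \<longrightarrow>
             (\<exists>P. degree P \<le> m j - 1 \<and> (\<forall>z. B_comp p q r a b \<kappa> n m \<nu> j z = poly P z))) \<and>
          (\<forall>i\<in>{1..p}. \<forall>l<n i.
             (\<Sum>j=1..q. circ_integral (\<lambda>z.
                z ^ l * B_comp p q r a b \<kappa> n m \<nu> j z * weight q r a b \<kappa> j i z)) = 0)"
  proof (intro allI impI conjI ballI)
    fix \<nu> :: complex and j assume j: "j \<in> {1..q}"
    show "\<exists>P. degree P \<le> m j - 1 \<and> (\<forall>z. B_comp p q r a b \<kappa> n m \<nu> j z = poly P z)"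
      unfolding B_comp_eq_sum [OF nd j order_refl]
      by (rule poly_of_coeffs [of "m j" "\<lambda>k. \<nu> * B_coeff p q r a b \<kappa> n m j k"]) auto
  next
    fix \<nu> :: complex and i l assume i: "i \<in> {1..p}" and l: "l < n i"
    have "(\<Sum>j=1..q. circ_integral (\<lambda>z.
            z ^ l * B_comp p q r a b \<kappa> n m \<nu> j z * weight q r a b \<kappa> j i z)) =
        \<nu> * (\<Sum>j=1..q. \<Sum>k<m j. B_coeff p q r a b \<kappa> n m j k * wcoef q r a b j (of_nat (k + l) + \<kappa> i))"
      unfolding sum_distrib_left [of \<nu>]
      by (intro sum.cong refl) (simp only: circ_integral_B_comp [OF rq wadm i _ nd] sum_distrib_left)
    then show "(\<Sum>j=1..q. circ_integral (\<lambda>z.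
            z ^ l * B_comp p q r a b \<kappa> n m \<nu> j z * weight q r a b \<kappa> j i z)) = 0"
      unfolding B_admissible_orthogonality [OF assms(2) reg size nd adm i l] by simp
  qed
  show "\<exists>P. degree P = m_max q m - 1 \<and> lead_coeff P = 1 \<and>
          (\<forall>z. B_comp p q r a b \<kappa> n m (nu_B p q r a b \<kappa> n m) (j_max q m) z = poly P z)"
  proof -
    let ?c = "\<lambda>k. nu_B p q r a b \<kappa> n m * B_coeff p q r a b \<kappa> n m (j_max q m) k"
    note lead = B_admissible_lead_coeff [OF assms(2) reg size nd adm]
    obtain P where P: "degree P \<le> m_max q m - 1" "\<And>k. coeff P k = (if k < m_max q m then ?c k else 0)"
      "\<And>z. poly P z = (\<Sum>k<m_max q m. ?c k * z ^ k)"
      by (rule poly_of_coeffs [of "m_max q m" ?c]) blast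
    \<comment> \<open>The coefficient at the degree bound is 1, so the bound is attained.\<close>
    have "coeff P (m_max q m - 1) = 1" using lead by (simp add: P(2))
    moreover from this have "degree P = m_max q m - 1"
      using P(1) by (intro antisym le_degree) simp_all
    ultimately show ?thesis
      using P(3) B_comp_eq_sum [OF nd mm(1) mm(4) [OF mm(1)]] by metis
  qed
  show "\<forall>N. (\<forall>i\<in>{1..p}. n i = step_line p N i) \<and> (\<forall>j\<in>{1..q}. m j = step_line q (N + 1) j) \<and>
          truncations_nonsingular (moment_matrix p q r a b \<kappa>) \<longrightarrow>
          (\<forall>S H Sb. gauss_borel (moment_matrix p q r a b \<kappa>) S H Sb \<longrightarrow>
             (\<forall>j\<in>{1..q}. \<forall>z.
                B_comp p q r a b \<kappa> n m (nu_B p q r a b \<kappa> n m) j z =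
                ltri_mult S (block_col q z) N j))"
  proof (intro allI impI ballI, elim conjE)
    fix N S H Sb j z
    assume "\<forall>i\<in>{1..p}. n i = step_line p N i" "\<forall>j\<in>{1..q}. m j = step_line q (N + 1) j"
      "truncations_nonsingular (moment_matrix p q r a b \<kappa>)"
      "gauss_borel (moment_matrix p q r a b \<kappa>) S H Sb" "j \<in> {1..q}"
    then show "B_comp p q r a b \<kappa> n m (nu_B p q r a b \<kappa> n m) j z = ltri_mult S (block_col q z) N j"
      by (intro B_step_line [OF assms(1,2) reg size nd adm]) auto
  qed
qed

end
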